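(* Let $\theta$ be a continuous binary substitution of constant length, in canonical form. Then the Ellis semigroup $E(X_\theta,\sigma)$ has exactly two minimal ideals, with exactly two idempotents each. Furthermore, let $v,\bar v,w,\bar w$ be the four bi-infinite fixed points of $\theta$, where $v_{-1}v_0=11$ and $w_{-1}w_0=01$. Then the four minimal idempotents $g_1,g_2,g_3,g_4$ are given in shorthand by $$\begin{array}{c||c|c|c|c} & v&\bar v&w&\bar w\\ \hline g_1& w&\bar w&w&\bar w\\ g_2&\bar w&w&w&\bar w\\ g_3&v&\bar v&v&\bar v\\ g_4&v&\bar v&\bar v&v\end{array}$$
   Context: A continuous substitution is a substitution $\theta$ on $\{0,1\}$ of constant length $r$ (i.e. $|\theta(0)|=|\theta(1)|=r$), aperiodic (its fixed point is not shift-periodic and $\theta(0)\neq\theta(1)$), with $\theta(0)=\overline{\theta(1)}$, where $\overline{B}$ is obtained from a finite or infinite word $B$ by interchanging $0$ and $1$. Canonical form means $\theta(a)_0=\theta(a)_{r-1}=a$ for $a\in\{0,1\}$ (words indexed from $0$). Bi-infinite words are written $x=\ldots x_{-1}\cdot x_0x_1\ldots$ and $\theta$ acts on them by concatenation, keeping the origin fixed. $\sigma$ is the shift $\sigma(x)_n=x_{n+1}$, and $X_\theta\subset\{0,1\}^{\mathbb{Z}}$ is the shift-orbit closure of a bi-infinite fixed point of $\theta$. The Ellis semigroup $E(X_\theta,\sigma)$ is the closure of $\{\sigma^n:n\in\mathbb{Z}\}$ in $X_\theta^{X_\theta}$ with the product topology, a semigroup under composition. An ideal is a nonempty $I\subset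 E$ with $EI\subset I$ (left ideal); it is minimal if it contains no proper ideal; an idempotent is minimal if it lies in a minimal ideal. Shorthand: the table lists the values of each $g_i$ at the four fixed points; each $g_i$ commutes with $\sigma$ and is the identity on all points of $X_\theta$ outside the shift orbits of the four fixed points, so these values determine $g_i$. *)

theory Defs
  imports "HOL-Analysis.Analysis"
begin

text \<open>
  The alphabet \<open>{0,1}\<close> is \<^typ>\<open>bool\<close>, with \<open>0 = False\<close> and \<open>1 = True\<close>.  A bi-infinite word is a
  function of type \<^typ>\<open>int \<Rightarrow> bool\<close>; the library topology on this type is the product topology
  for the discrete topology on \<^typ>\<open>bool\<close>.  A substitution maps each letter to a finite word.
\<close>

type_synonym biword = "int \<Rightarrow> bool"
type_synonym subst = "bool \<Rightarrow> bool list"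

definition bar :: "biword \<Rightarrow> biword" where
  "bar x = (\<lambda>n. \<not> x n)"

text \<open>\<open>shift n\<close> is the \<open>n\<close>-th power of the shift, for every integer \<open>n\<close>.\<close>

definition shift :: "int \<Rightarrow> biword \<Rightarrow> biword" where
  "shift n x = (\<lambda>k. x (k + n))"

definition shift_periodic :: "biword \<Rightarrow> bool" where
  "shift_periodic x \<longleftrightarrow> (\<exists>p. p \<noteq> 0 \<and> shift p x = x)"

definition constant_length :: "nat \<Rightarrow> subst \<Rightarrow> bool" where
  "constant_length r \<theta> \<longleftrightarrow> r > 0 \<and> (\<forall>a. length (\<theta> a) = r)"

text \<open>
  Concatenation of the words \<open>\<theta> (x m)\<close>, with \<open>\<theta> (x 0)\<close> starting at the origin, for \<open>\<theta>\<close> of constant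
  length \<open>r\<close>: the word \<open>\<theta> (x m)\<close> occupies the positions \<open>r * m, \<dots>, r * m + r - 1\<close>
  (for negative \<open>m\<close> as well, since \<open>div\<close> rounds towards minus infinity).
\<close>

definition subst_action :: "subst \<Rightarrow> biword \<Rightarrow> biword" where
  "subst_action \<theta> x =
     (\<lambda>n. let r = int (length (\<theta> False)) in \<theta> (x (n div r)) ! nat (n mod r))"

definition fixed_points :: "subst \<Rightarrow> biword set" where
  "fixed_points \<theta> = {x. subst_action \<theta> x = x}"

text \<open>
  No fixed point may be periodic: the non-periodic word \<open>\<dots>000.111\<dots>\<close> is a fixed point of
  \<open>0 \<mapsto> 000, 1 \<mapsto> 111\<close>, which is not aperiodic.
\<close>

definition aperiodic :: "subst \<Rightarrow> bool" where
  "aperiodic \<theta> \<longleftrightarrow> \<theta> False \<noteq> \<theta> True \<and> (\<forall>x\<in>fixed_points \<theta>. \<not> shift_periodic x)"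

definition continuous_substitution :: "nat \<Rightarrow> subst \<Rightarrow> bool" where
  "continuous_substitution r \<theta> \<longleftrightarrow>
     constant_length r \<theta> \<and> aperiodic \<theta> \<and> \<theta> False = map Not (\<theta> True)"

definition canonical_form :: "nat \<Rightarrow> subst \<Rightarrow> bool" where
  "canonical_form r \<theta> \<longleftrightarrow> (\<forall>a. \<theta> a ! 0 = a \<and> \<theta> a ! (r - 1) = a)"

definition shift_orbit :: "biword \<Rightarrow> biword set" where
  "shift_orbit x = range (\<lambda>n. shift n x)"

text \<open>
  The space \<open>X\<^sub>\<theta>\<close>: the closure of the shift orbit of a bi-infinite fixed point.  For continuous
  substitutions in canonical form it does not depend on the fixed point, so the definite
  description denotes it.
\<close>

definition subst_shift :: "subst \<Rightarrow> biword set" where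
  "subst_shift \<theta> = (THE X. \<exists>u\<in>fixed_points \<theta>. X = closure (shift_orbit u))"

text \<open>
  Self-maps of \<open>X\<close> are represented by functions that are \<^term>\<open>undefined\<close> outside \<open>X\<close>, as in the
  \<^const>\<open>topspace\<close> of \<^const>\<open>product_topology\<close>; their composition is \<open>compose X\<close>.
\<close>

definition ellis_semigroup :: "biword set \<Rightarrow> (biword \<Rightarrow> biword) set" where
  "ellis_semigroup X =
     product_topology (\<lambda>_. top_of_set X) X closure_of range (\<lambda>n. restrict (shift n) X)"

definition ellis_ideal :: "biword set \<Rightarrow> (biword \<Rightarrow> biword) set \<Rightarrow> bool" where
  "ellis_ideal X I \<longleftrightarrow>
     I \<noteq> {} \<and> I \<subseteq> ellis_semigroup X \<and> (\<forall>f\<in>ellis_semigroup X. \<forall>g\<in>I. compose X f g \<in> I)"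

definition minimal_ideals :: "biword set \<Rightarrow> (biword \<Rightarrow> biword) set set" where
  "minimal_ideals X = {I. ellis_ideal X I \<and> (\<forall>J. ellis_ideal X J \<longrightarrow> \<not> J \<subset> I)}"

definition ellis_idempotents :: "biword set \<Rightarrow> (biword \<Rightarrow> biword) set" where
  "ellis_idempotents X = {g \<in> ellis_semigroup X. compose X g g = g}"

definition minimal_idempotents :: "biword set \<Rightarrow> (biword \<Rightarrow> biword) set" where
  "minimal_idempotents X = {g \<in> ellis_idempotents X. \<exists>I\<in>minimal_ideals X. g \<in> I}"

text \<open>
  \<open>shorthand \<theta> g [(v, a), (v', b), \<dots>]\<close>: the map \<open>g\<close> of \<open>X\<^sub>\<theta>\<close> is given by the row
  \<open>g v = a, g v' = b, \<dots>\<close> of values at the fixed points, commutation with the shift, and being the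
  identity off the orbits of the fixed points.
\<close>

definition shorthand :: "subst \<Rightarrow> (biword \<Rightarrow> biword) \<Rightarrow> (biword \<times> biword) list \<Rightarrow> bool" where
  "shorthand \<theta> g vs \<longleftrightarrow>
     (\<forall>x\<in>subst_shift \<theta>. g (shift 1 x) = shift 1 (g x)) \<and>
     (\<forall>x\<in>subst_shift \<theta> - (\<Union>u\<in>fixed_points \<theta>. shift_orbit u). g x = x) \<and>
     (\<forall>(u, y)\<in>set vs. u \<in> subst_shift \<theta> \<and> g u = y)"

end

theory Submission
  imports Defs
begin

text \<open>
  Cut a point of \<open>X\<^sub>\<theta>\<close> into blocks \<open>\<theta>\<^sup>k(0)\<close>, \<open>\<theta>\<^sup>k(1)\<close>, which are complementary.  A limit of
  shifts by multiples of \<open>r\<^sup>k\<close>, for every \<open>k\<close>, maps blocks to blocks.  Unless block boundaries stay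
  near the origin, that is, unless \<open>x\<close> lies in the orbit of a fixed point, it therefore sends \<open>x\<close> to
  \<open>x\<close> or its complement, and it permits the fixed points \<open>v, w\<close> only the values read off from the
  two-letter words \<open>v\<^sub>m\<^sub>-\<^sub>1v\<^sub>m\<close> and \<open>w\<^sub>m\<^sub>-\<^sub>1w\<^sub>m\<close>.  These agree for \<open>m > 0\<close> and are complementary for
  \<open>m < 0\<close>, and every two-letter word occurs on both sides of the origin of \<open>v\<close>.  Squaring suitable limits
  removes the complements and yields the four idempotents.  Every idempotent is a limit of this kind, and
  every left ideal contains one; multiplying by \<open>g\<^sub>1\<close> and squaring produces \<open>g\<^sub>1\<close> or \<open>g\<^sub>2\<close>, so it
  contains all \<open>f\<close> with \<open>f v = f w\<close> or all \<open>f\<close> with \<open>f v\<close> the complement of \<open>f w\<close>.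
\<close>

subsection \<open>Self-maps of spaces of words\<close>

text \<open>Over discrete letters, the sets prescribing finitely many coordinates form a
  neighbourhood base at \<open>x\<close>.\<close>

lemma closure_fun_discrete_iff:
  fixes x :: "'a \<Rightarrow> 'b::discrete_topology"
  shows "x \<in> closure A \<longleftrightarrow> (\<forall>D. finite D \<longrightarrow> (\<exists>y\<in>A. \<forall>i\<in>D. y i = x i))"
proof (intro iffI allI impI)
  fix D :: "'a set" assume x: "x \<in> closure A" and "finite D"
  have "open {y. \<forall>i\<in>D. y i \<in> {x i}}"
    using product_topology_basis'[OF \<open>finite D\<close>, of "\<lambda>i. {x i}" "\<lambda>i. i"] by (simp add: open_discrete)
  then have "A \<inter> {y. \<forall>i\<in>D. y i \<in> {x i}} \<noteq> {}"
    using x by (auto simp: closure_iff_nhds_not_empty)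
  then show "\<exists>y\<in>A. \<forall>i\<in>D. y i = x i" by auto
next
  assume *: "\<forall>D. finite D \<longrightarrow> (\<exists>y\<in>A. \<forall>i\<in>D. y i = x i)"
  have "A \<inter> S \<noteq> {}" if S: "open S" "x \<in> S" for S
  proof -
    obtain U where U: "x \<in> Pi\<^sub>E UNIV U" "finite {i. U i \<noteq> UNIV}" "Pi\<^sub>E UNIV U \<subseteq> S"
      using product_topology_open_contains_basis[of "\<lambda>_. euclidean" UNIV S x] S
      by (auto simp: open_fun_def)
    obtain y where "y \<in> A" "\<forall>i\<in>{i. U i \<noteq> UNIV}. y i = x i" using * U(2) by blast
    moreover from this U(1) have "y \<in> Pi\<^sub>E UNIV U" by (force simp: PiE_iff)
    ultimately show ?thesis using U(3) by auto
  qed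
  then show "x \<in> closure A" unfolding closure_iff_nhds_not_empty by blast
qed

text \<open>A basic neighbourhood restricts finitely many points of \<open>X\<close>, and the value
  at each of them in finitely many positions; one finite set \<open>Q\<close> of pairs records
  both.\<close>

lemma in_closure_of_self_maps_iff:
  fixes X :: "('a \<Rightarrow> 'b::discrete_topology) set"
  assumes P: "P \<subseteq> X \<rightarrow>\<^sub>E X"
  shows "f \<in> product_topology (\<lambda>_. top_of_set X) X closure_of P \<longleftrightarrow>
    f \<in> X \<rightarrow>\<^sub>E X \<and> (\<forall>Q. finite Q \<longrightarrow> Q \<subseteq> X \<times> UNIV \<longrightarrow> (\<exists>g\<in>P. \<forall>(x, i)\<in>Q. g x i = f x i))"
    (is "_ \<in> ?T closure_of P \<longleftrightarrow> _")
proof (intro iffI conjI allI impI)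
  assume f: "f \<in> ?T closure_of P"
  then show fX: "f \<in> X \<rightarrow>\<^sub>E X" by (auto simp: in_closure_of)
  fix Q :: "(('a \<Rightarrow> 'b) \<times> 'a) set" assume Q: "finite Q" "Q \<subseteq> X \<times> UNIV"
  define U where "U x = {y \<in> X. \<forall>i. (x, i) \<in> Q \<longrightarrow> y i = f x i}" for x
  have fin: "finite {i. (x, i) \<in> Q}" for x
    by (rule finite_subset[OF _ finite_imageI[OF Q(1), of snd]]) force
  have "openin (top_of_set X) (U x)" for x
  proof -
    have "open {y. \<forall>i\<in>{i. (x, i) \<in> Q}. y i \<in> {f x i}}"
      using product_topology_basis'[OF fin, of x "\<lambda>i. {f x i}" "\<lambda>i. i"] by (simp add: open_discrete)
    then show ?thesis by (auto simp: openin_open U_def)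
  qed
  moreover have "finite {x \<in> X. U x \<noteq> topspace (top_of_set X)}"
    by (rule finite_subset[OF _ finite_imageI[OF Q(1), of fst]]) (force simp: U_def)
  ultimately have "openin ?T (Pi\<^sub>E X U)"
    by (subst openin_PiE_gen) auto
  moreover have "f \<in> Pi\<^sub>E X U" using fX by (auto simp: U_def PiE_iff)
  ultimately obtain g where "g \<in> P" "g \<in> Pi\<^sub>E X U" using f by (auto simp: in_closure_of)
  moreover from this have "g x i = f x i" if "(x, i) \<in> Q" for x i
    using that Q(2) PiE_mem[of g X U x] by (auto simp: U_def)
  ultimately show "\<exists>g\<in>P. \<forall>(x, i)\<in>Q. g x i = f x i" by blast
next
  assume *: "f \<in> X \<rightarrow>\<^sub>E X \<and> (\<forall>Q. finite Q \<longrightarrow> Q \<subseteq> X \<times> UNIV \<longrightarrow> (\<exists>g\<in>P. \<forall>(x, i)\<in>Q. g x i = f x i))"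
  have "\<exists>g\<in>P. g \<in> S" if S: "openin ?T S" "f \<in> S" for S
  proof -
    obtain U where U: "f \<in> Pi\<^sub>E X U" "\<forall>x. openin (top_of_set X) (U x)"
        "finite {x. U x \<noteq> X}" "Pi\<^sub>E X U \<subseteq> S"
      using product_topology_open_contains_basis[OF S] by auto
    have "\<exists>D. finite D \<and> (\<forall>y\<in>X. (\<forall>i\<in>D. y i = f x i) \<longrightarrow> y \<in> U x)" if "x \<in> X" for x
    proof -
      obtain V where V: "open V" "U x = X \<inter> V" using U(2) by (metis openin_open)
      \<comment> \<open>Applied to the closed set \<open>- V\<close>, the closure criterion gives
        finitely many positions that force a word into \<open>V\<close>.\<close>
      have "f x \<notin> - V" using V U(1) \<open>x \<in> X\<close> by (auto simp: PiE_iff)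
      then have "f x \<notin> closure (- V)" using V(1) by (metis closed_Compl closure_closed)
      then obtain D where D: "finite D" "\<not> (\<exists>y\<in>- V. \<forall>i\<in>D. y i = f x i)"
        unfolding closure_fun_discrete_iff by blast
      have "y \<in> U x" if "y \<in> X" "\<forall>i\<in>D. y i = f x i" for y
        using that V(2) D(2) by blast
      then show ?thesis using D(1) by (intro exI[of _ D]) simp
    qed
    then have "\<forall>x\<in>X. \<exists>D. finite D \<and> (\<forall>y\<in>X. (\<forall>i\<in>D. y i = f x i) \<longrightarrow> y \<in> U x)" ..
    then obtain D where "\<forall>x\<in>X. finite (D x) \<and> (\<forall>y\<in>X. (\<forall>i\<in>D x. y i = f x i) \<longrightarrow> y \<in> U x)"
      by (rule bchoice[THEN exE])
    then have D: "\<And>x. x \<in> X \<Longrightarrow> finite (D x)"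
        "\<And>x y. \<lbrakk>x \<in> X; y \<in> X; \<forall>i\<in>D x. y i = f x i\<rbrakk> \<Longrightarrow> y \<in> U x" by simp_all
    let ?Q = "SIGMA x:X \<inter> {x. U x \<noteq> X}. D x"
    have "finite ?Q" using U(3) D(1) by (intro finite_SigmaI) auto
    moreover have "?Q \<subseteq> X \<times> UNIV" by auto
    ultimately have "\<exists>g\<in>P. \<forall>(x, i)\<in>?Q. g x i = f x i"
      by (rule *[THEN conjunct2, THEN spec, THEN mp, THEN mp])
    then obtain g where g: "g \<in> P" "\<forall>(x, i)\<in>?Q. g x i = f x i" by blast
    have "g \<in> Pi\<^sub>E X U"
    proof (rule PiE_I)
      fix x assume x: "x \<in> X"
      then have "g x \<in> X" using P g(1) by blast
      then show "g x \<in> U x" using D(2)[OF x] g(2) x by (cases "U x = X") auto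
    qed (use P g(1) in auto)
    then show ?thesis using g U by auto
  qed
  then have "\<forall>S. f \<in> S \<and> openin ?T S \<longrightarrow> (\<exists>g. g \<in> P \<and> g \<in> S)" by metis
  moreover have "f \<in> topspace ?T" using *[THEN conjunct1] by simp
  ultimately show "f \<in> ?T closure_of P" unfolding in_closure_of by (rule conjI[rotated])
qed

lemma compact_UNIV_biword: "compact (UNIV :: biword set)"
proof -
  have "compact_space (euclidean :: bool topology)"
    by (simp add: compact_space_def finite_imp_compact)
  then have "compact_space (product_topology (\<lambda>_. euclidean :: bool topology) (UNIV :: int set))"
    unfolding compact_space_product_topology by blast
  then have "compact_space (euclidean :: biword topology)"
    unfolding euclidean_product_topology .
  then show ?thesis unfolding compact_space_def by simp
qed

subsection \<open>Limits of shifts\<close>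

text \<open>
  The closure of \<open>{shift n | n \<in> S}\<close>, stated through finitely many coordinates, so that most of
  the topology reduces to picking one \<open>n\<close> for finitely many pairs of a point and a position.
\<close>

definition shift_limits :: "biword set \<Rightarrow> int set \<Rightarrow> (biword \<Rightarrow> biword) set" where
  "shift_limits X S = {f \<in> X \<rightarrow>\<^sub>E X.
     \<forall>Q. finite Q \<longrightarrow> Q \<subseteq> X \<times> UNIV \<longrightarrow> (\<exists>n\<in>S. \<forall>(x, i)\<in>Q. f x i = x (i + n))}"

lemma shift_limits_PiE: "f \<in> shift_limits X S \<Longrightarrow> f \<in> X \<rightarrow>\<^sub>E X"
  by (simp add: shift_limits_def)

lemma shift_limits_mem: "f \<in> shift_limits X S \<Longrightarrow> x \<in> X \<Longrightarrow> f x \<in> X"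
  by (auto simp: shift_limits_def)

lemma shift_limits_witness:
  assumes "f \<in> shift_limits X S" "finite Q" "Q \<subseteq> X \<times> UNIV"
  obtains n where "n \<in> S" "\<And>x i. (x, i) \<in> Q \<Longrightarrow> f x i = x (i + n)"
proof -
  have "\<exists>n\<in>S. \<forall>(x, i)\<in>Q. f x i = x (i + n)"
    using assms by (simp add: shift_limits_def)
  then obtain n where "n \<in> S" "\<forall>(x, i)\<in>Q. f x i = x (i + n)" by blast
  then show thesis using that[of n] by auto
qed

lemma shift_limits_witness_1:
  assumes "f \<in> shift_limits X S" "x \<in> X" "finite D"
  obtains n where "n \<in> S" "\<And>i. i \<in> D \<Longrightarrow> f x i = x (i + n)"
proof -
  obtain n where "n \<in> S" "\<And>y i. (y, i) \<in> {x} \<times> D \<Longrightarrow> f y i = y (i + n)"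
    by (rule shift_limits_witness[OF assms(1), of "{x} \<times> D"]) (use assms(2,3) in auto)
  then show thesis using that[of n] by simp
qed

lemma shift_limits_witness_2:
  assumes "f \<in> shift_limits X S" "x \<in> X" "y \<in> X" "finite D"
  obtains n where "n \<in> S" "\<And>i. i \<in> D \<Longrightarrow> f x i = x (i + n)" "\<And>i. i \<in> D \<Longrightarrow> f y i = y (i + n)"
proof -
  obtain n where "n \<in> S" "\<And>z i. (z, i) \<in> {x, y} \<times> D \<Longrightarrow> f z i = z (i + n)"
    by (rule shift_limits_witness[OF assms(1), of "{x, y} \<times> D"]) (use assms(2-4) in auto)
  then show thesis using that[of n] by simp
qed

lemma shift_limitsI:
  assumes "f \<in> X \<rightarrow>\<^sub>E X"
    and "\<And>Q. finite Q \<Longrightarrow> Q \<subseteq> X \<times> UNIV \<Longrightarrow> \<exists>n\<in>S. \<forall>(x, i)\<in>Q. f x i = x (i + n)"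
  shows "f \<in> shift_limits X S"
  using assms by (simp add: shift_limits_def)

lemma shift_limits_mono: "S \<subseteq> T \<Longrightarrow> f \<in> shift_limits X S \<Longrightarrow> f \<in> shift_limits X T"
  by (simp add: shift_limits_def) (meson subsetD)

text \<open>Closure commutes with finite unions: finite sets \<open>Q j\<close> refuting the single
  \<open>S j\<close> unite to one that refutes them all.\<close>

lemma shift_limits_UN:
  assumes f: "f \<in> shift_limits X (\<Union>j\<in>J. S j)" and J: "finite J"
  shows "\<exists>j\<in>J. f \<in> shift_limits X (S j)"
proof (rule ccontr)
  assume *: "\<not> ?thesis"
  define M where "M j Q \<longleftrightarrow> (\<exists>n\<in>S j. \<forall>(x, i)\<in>Q. f x i = x (i + n))" for j Q
  have "\<exists>Q. finite Q \<and> Q \<subseteq> X \<times> UNIV \<and> \<not> M j Q" if "j \<in> J" for j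
  proof (rule ccontr)
    assume "\<not> ?thesis"
    then have "f \<in> shift_limits X (S j)"
      by (intro shift_limitsI shift_limits_PiE[OF f]) (auto simp: M_def)
    then show False using * that by blast
  qed
  then obtain Q where Q: "\<And>j. j \<in> J \<Longrightarrow> finite (Q j)" "\<And>j. j \<in> J \<Longrightarrow> Q j \<subseteq> X \<times> UNIV"
      "\<And>j. j \<in> J \<Longrightarrow> \<not> M j (Q j)"
    by metis
  have "finite (\<Union>j\<in>J. Q j)" "(\<Union>j\<in>J. Q j) \<subseteq> X \<times> UNIV" using Q(1,2) J by auto
  then obtain n where n: "n \<in> (\<Union>j\<in>J. S j)" "\<And>x i. (x, i) \<in> (\<Union>j\<in>J. Q j) \<Longrightarrow> f x i = x (i + n)"
    by (rule shift_limits_witness[OF f _ _ that])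
  then obtain j where j: "j \<in> J" "n \<in> S j" by blast
  then have "\<forall>(x, i)\<in>Q j. f x i = x (i + n)" using n(2) by auto
  then show False using Q(3)[OF j(1)] j(2) unfolding M_def by blast
qed

text \<open>
  The limit set of \<open>g\<close> may depend on the shift approximating \<open>f\<close>: this produces
  approximate inverses without knowing that the residues of \<open>g\<close> are compatible.
\<close>

lemma shift_limits_compose_dependent:
  assumes f: "f \<in> shift_limits X S" and g: "g \<in> X \<rightarrow>\<^sub>E X"
    and gT: "\<And>m. m \<in> S \<Longrightarrow> g \<in> shift_limits X (T m)"
    and ST: "\<And>m n. m \<in> S \<Longrightarrow> n \<in> T m \<Longrightarrow> m + n \<in> U"
  shows "compose X f g \<in> shift_limits X U"
proof (rule shift_limitsI)
  show "compose X f g \<in> X \<rightarrow>\<^sub>E X"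
    using shift_limits_PiE[OF f] g by (auto simp: compose_def)
  fix Q :: "(biword \<times> int) set" assume Q: "finite Q" "Q \<subseteq> X \<times> UNIV"
  obtain m where m: "m \<in> S" "\<And>x i. (x, i) \<in> Q \<Longrightarrow> f (g x) i = g x (i + m)"
  proof (rule shift_limits_witness[OF f, of "(\<lambda>(x, i). (g x, i)) ` Q"])
    fix m assume m: "m \<in> S" "\<And>x i. (x, i) \<in> (\<lambda>(x, i). (g x, i)) ` Q \<Longrightarrow> f x i = x (i + m)"
    have "f (g x) i = g x (i + m)" if "(x, i) \<in> Q" for x i
      by (rule m(2)) (use imageI[OF that, of "\<lambda>(x, i). (g x, i)"] in simp)
    then show thesis by (rule that[OF m(1)])
  qed (use Q g in auto)
  obtain n where n: "n \<in> T m" "\<And>x i. (x, i) \<in> Q \<Longrightarrow> g x (i + m) = x (i + m + n)"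
  proof (rule shift_limits_witness[OF gT[OF m(1)], of "(\<lambda>(x, i). (x, i + m)) ` Q"])
    fix n assume n: "n \<in> T m" "\<And>x i. (x, i) \<in> (\<lambda>(x, i). (x, i + m)) ` Q \<Longrightarrow> g x i = x (i + n)"
    have "g x (i + m) = x (i + m + n)" if "(x, i) \<in> Q" for x i
      by (rule n(2)) (use imageI[OF that, of "\<lambda>(x, i). (x, i + m)"] in simp)
    then show thesis by (rule that[OF n(1)])
  qed (use Q in auto)
  show "\<exists>n\<in>U. \<forall>(x, i)\<in>Q. compose X f g x i = x (i + n)"
  proof (intro bexI ballI)
    show "m + n \<in> U" using ST m(1) n(1) .
    fix p assume "p \<in> Q"
    then show "case p of (x, i) \<Rightarrow> compose X f g x i = x (i + (m + n))"
      using m(2) n(2) Q(2) by (cases p) (auto simp: compose_def algebra_simps)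
  qed
qed

lemma shift_limits_compose:
  assumes "f \<in> shift_limits X S" "g \<in> shift_limits X T"
    and "\<And>m n. m \<in> S \<Longrightarrow> n \<in> T \<Longrightarrow> m + n \<in> U"
  shows "compose X f g \<in> shift_limits X U"
  using assms shift_limits_compose_dependent[of f X S g "\<lambda>_. T"] shift_limits_PiE[of g] by blast

text \<open>One shift \<open>n\<close> approximates both coordinates to be compared, and it commutes
  with \<open>shift k\<close>.\<close>

lemma shift_limits_shift:
  assumes f: "f \<in> shift_limits X S" and x: "x \<in> X" "shift k x \<in> X"
  shows "f (shift k x) = shift k (f x)"
proof
  fix i
  obtain n where "\<And>y j. (y, j) \<in> {(shift k x, i), (x, i + k)} \<Longrightarrow> f y j = y (j + n)"
    by (rule shift_limits_witness[OF f, of "{(shift k x, i), (x, i + k)}"]) (use x in auto)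
  from this[of "shift k x" i] this[of x "i + k"]
  have "f (shift k x) i = shift k x (i + n)" "f x (i + k) = x (i + k + n)" by auto
  then show "f (shift k x) i = shift k (f x) i" by (simp add: shift_def algebra_simps)
qed

lemma shift_limits_bar:
  assumes f: "f \<in> shift_limits X S" and x: "x \<in> X" "bar x \<in> X"
  shows "f (bar x) = bar (f x)"
proof
  fix i
  obtain n where "f (bar x) i = bar x (i + n)" "f x i = x (i + n)"
    by (rule shift_limits_witness_2[OF f x(2,1), of "{i}"]) auto
  then show "f (bar x) i = bar (f x) i" by (simp add: bar_def)
qed

lemma ellis_semigroup_eq_shift_limits:
  assumes X: "\<And>n x. x \<in> X \<Longrightarrow> shift n x \<in> X"
  shows "ellis_semigroup X = shift_limits X UNIV"
proof -
  have P: "range (\<lambda>n. restrict (shift n) X) \<subseteq> X \<rightarrow>\<^sub>E X" using X by auto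
  have "(\<exists>g\<in>range (\<lambda>n. restrict (shift n) X). \<forall>(x, i)\<in>Q. g x i = f x i) \<longleftrightarrow>
      (\<exists>n\<in>UNIV. \<forall>(x, i)\<in>Q. f x i = x (i + n))" if "Q \<subseteq> X \<times> UNIV" for f :: "biword \<Rightarrow> biword" and Q
  proof -
    have "(\<forall>(x, i)\<in>Q. restrict (shift n) X x i = f x i) \<longleftrightarrow> (\<forall>(x, i)\<in>Q. f x i = x (i + n))" for n
      using that by (intro ball_cong refl) (auto simp: shift_def)
    then show ?thesis by simp
  qed
  then show ?thesis
    unfolding ellis_semigroup_def shift_limits_def set_eq_iff mem_Collect_eq
      in_closure_of_self_maps_iff[OF P]
    by meson
qed

text \<open>By compactness, the decreasing nonempty closures of the tails of the sequence have a
  common point.\<close>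

lemma shift_limits_cluster_point:
  fixes s :: "nat \<Rightarrow> int"
  assumes "closed X" and X: "\<And>n x. x \<in> X \<Longrightarrow> shift n x \<in> X"
  obtains h where "\<And>k. h \<in> shift_limits X (s ` {k..})"
proof -
  let ?T = "product_topology (\<lambda>_. top_of_set X) X"
  let ?P = "\<lambda>k. (\<lambda>n. restrict (shift (s n)) X) ` {k..}"
  have P: "?P k \<subseteq> X \<rightarrow>\<^sub>E X" for k using X by auto
  have "compact X"
    using compact_Int_closed[OF compact_UNIV_biword \<open>closed X\<close>] by simp
  then have "compact_space ?T" by (simp add: compact_space_product_topology compact_space_subtopology)
  moreover have "closedin ?T (?T closure_of ?P k)" for k by simp
  moreover have "?T closure_of ?P k \<noteq> {}" for k
    using closure_of_subset[of "?P k" ?T] P by auto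
  moreover have "decseq (\<lambda>k. ?T closure_of ?P k)"
    by (intro decseq_SucI closure_of_mono) auto
  ultimately have "(\<Inter>k. ?T closure_of ?P k) \<noteq> {}"
    by (intro compact_space_imp_nest) auto
  then obtain h where h: "\<And>k. h \<in> ?T closure_of ?P k" by blast
  have "h \<in> shift_limits X (s ` {k..})" for k
  proof (rule shift_limitsI)
    show "h \<in> X \<rightarrow>\<^sub>E X" using h[of k] in_closure_of_self_maps_iff[OF P] by blast
    fix Q :: "(biword \<times> int) set" assume Q: "finite Q" "Q \<subseteq> X \<times> UNIV"
    then have "\<exists>g\<in>?P k. \<forall>(x, i)\<in>Q. g x i = h x i"
      using h[of k] in_closure_of_self_maps_iff[OF P] by blast
    then obtain j where "j \<in> {k..}" "\<forall>(x, i)\<in>Q. restrict (shift (s j)) X x i = h x i" by blast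
    moreover from this(2) have "\<forall>(x, i)\<in>Q. h x i = x (i + s j)"
      using Q(2) by (fastforce simp: shift_def)
    ultimately show "\<exists>n\<in>s ` {k..}. \<forall>(x, i)\<in>Q. h x i = x (i + n)" by blast
  qed
  then show thesis using that by blast
qed

subsection \<open>Fixed points and their blocks\<close>

text \<open>
  Repeated division by \<open>R\<close> leads to \<open>0\<close> or \<open>-1\<close>, so the letters there determine a fixed
  point; the test \<open>R < 2\<close> only serves termination.
\<close>

function digit_word :: "int \<Rightarrow> (int \<Rightarrow> bool) \<Rightarrow> bool \<Rightarrow> bool \<Rightarrow> biword" where
  "digit_word R c a b n =
     (if n = 0 then b else if n = -1 \<or> R < 2 then a
      else digit_word R c a b (n div R) \<noteq> c (n mod R))"
  by auto
termination
\<comment> \<open>Both stopping points \<open>0\<close> and \<open>-1\<close> have measure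
  \<open>0\<close>; on the negative side the measure is the distance to \<open>-1\<close>.\<close>
proof (relation "Wellfounded.measure (\<lambda>(R, c, a, b, n). nat (if n \<ge> 0 then n else - n - 1))", goal_cases)
  case (2 R c a b n)
  then have R: "R \<ge> 2" and n: "n > 0 \<or> n < -1" by auto
  have "n < n div R" if "n < -1"
  proof (rule ccontr)
    assume "\<not> n < n div R"
    have "n < R * (n div R) + R"
      using R mult_div_mod_eq[of R n] pos_mod_bound[of R n] by linarith
    also have "\<dots> \<le> R * (n + 1)"
      using \<open>\<not> n < n div R\<close> R mult_left_mono[of "n div R" n R] by (simp add: algebra_simps)
    also have "\<dots> \<le> 2 * (n + 1)"
      using R \<open>n < -1\<close> by (intro mult_right_mono_neg) auto
    finally show False using \<open>n < -1\<close> by simp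
  qed
  moreover have "n div R < n" "0 \<le> n div R" if "n > 0"
    using that R by (auto simp: int_div_less_self pos_imp_zdiv_nonneg_iff)
  moreover have "n div R < 0" if "n < 0"
    using that R by (simp add: div_neg_pos_less0)
  ultimately show ?case using n by auto
qed auto

declare digit_word.simps [simp del]

locale canonical_substitution =
  fixes r :: nat and \<theta> :: subst
  assumes continuous: "continuous_substitution r \<theta>" and canonical: "canonical_form r \<theta>"
begin

definition R :: int where "R = int r"

text \<open>As \<open>\<theta>(1)\<close> is the complement of \<open>\<theta>(0)\<close>, the substitution adds \<open>c\<close> modulo 2 to a letter.\<close>

definition c :: "int \<Rightarrow> bool" where "c i = \<theta> False ! nat i"

abbreviation F :: "biword set" where "F \<equiv> fixed_points \<theta>"

lemma length_theta: "length (\<theta> a) = r" and r_pos: "r > 0"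
  using continuous by (auto simp: continuous_substitution_def constant_length_def)

lemma fixed_not_periodic: "x \<in> F \<Longrightarrow> \<not> shift_periodic x"
  using continuous by (auto simp: continuous_substitution_def aperiodic_def)

lemma theta_nth:
  assumes "0 \<le> i" "i < R"
  shows "\<theta> a ! nat i = (a \<noteq> c i)"
proof (cases a)
  case True
  have "\<theta> False ! nat i = (\<not> \<theta> True ! nat i)"
    using continuous assms length_theta[of True]
    by (simp add: continuous_substitution_def R_def)
  then show ?thesis using True by (simp add: c_def)
qed (simp add: c_def)

lemma R_pos: "R > 0" using r_pos by (simp add: R_def)

lemma subst_action_eq: "subst_action \<theta> x n = (x (n div R) \<noteq> c (n mod R))"
  using theta_nth[of "n mod R" "x (n div R)"] R_pos
  by (simp add: subst_action_def length_theta Let_def flip: R_def)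

lemma fixed_points_iff: "x \<in> F \<longleftrightarrow> (\<forall>n. x n = (x (n div R) \<noteq> c (n mod R)))"
  by (auto simp: fixed_points_def subst_action_eq fun_eq_iff)

lemma c_first: "\<not> c 0" and c_last: "\<not> c (R - 1)"
proof -
  show "\<not> c 0" using canonical by (simp add: c_def canonical_form_def)
  have "nat (R - 1) = r - 1" using r_pos by (simp add: R_def nat_diff_distrib)
  then show "\<not> c (R - 1)" using canonical by (simp add: c_def canonical_form_def)
qed

text \<open>If all inner digits vanished, a constant word would be a periodic fixed point.\<close>

lemma ex_digit: "\<exists>j. 0 < j \<and> j < R - 1 \<and> c j"
proof (rule ccontr)
  assume *: "\<not> ?thesis"
  have "\<not> c i" if "0 \<le> i" "i < R" for i
  proof (cases "i = 0 \<or> i = R - 1")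
    case False
    then have "0 < i" "i < R - 1" using that by auto
    then show ?thesis using * by blast
  qed (use c_first c_last in auto)
  then have "(\<lambda>_. True) \<in> F" using R_pos by (simp add: fixed_points_iff)
  moreover have "shift_periodic (\<lambda>_. True)"
    unfolding shift_periodic_def by (intro exI[of _ 1]) (simp add: shift_def)
  ultimately show False using fixed_not_periodic by blast
qed

lemma R_ge_3: "R \<ge> 3" using ex_digit by auto

lemma fixed_digit:
  assumes "u \<in> F" "0 \<le> i" "i < R"
  shows "u (R * q + i) = (u q \<noteq> c i)"
proof -
  have "(R * q + i) div R = q" "(R * q + i) mod R = i" using assms(2,3) by auto
  then show ?thesis using assms(1)[unfolded fixed_points_iff, rule_format, of "R * q + i"] by simp
qed

text \<open>Canonical form enters at \<open>0\<close> and \<open>-1\<close>: each is its own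
  quotient by \<open>R\<close>, with remainder \<open>0\<close> and \<open>R - 1\<close>, where
  \<open>c\<close> vanishes. Elsewhere the recursion is the fixed point equation.\<close>

lemma digit_word_fixed: "digit_word R c a b \<in> F"
proof -
  have "digit_word R c a b n = (digit_word R c a b (n div R) \<noteq> c (n mod R))" for n
  proof -
    consider "n = 0" | "n = -1" | "n \<noteq> 0" "n \<noteq> -1" by blast
    then show ?thesis
    proof cases
      case 1
      then show ?thesis using c_first by simp
    next
      case 2
      have "(-1) div R = -1" "(-1) mod R = R - 1"
        using R_ge_3 by (simp_all add: div_pos_neg_trivial zmod_minus1 div_eq_minus1)
      then show ?thesis using 2 c_last by simp
    next
      case 3
      then show ?thesis using R_ge_3 by (subst digit_word.simps) simp
    qed
  qed
  then show ?thesis unfolding fixed_points_iff by blast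
qed

lemma digit_word_0 [simp]: "digit_word R c a b 0 = b"
  and digit_word_minus_1 [simp]: "digit_word R c a b (-1) = a"
  by (subst digit_word.simps; simp)+

definition v :: biword where "v = digit_word R c True True"

definition w :: biword where "w = digit_word R c False True"

lemma v_fixed: "v \<in> F" and w_fixed: "w \<in> F"
  by (simp_all add: v_def w_def digit_word_fixed)

lemma v_0: "v 0" and v_minus_1: "v (-1)" and w_0: "w 0" and w_minus_1: "\<not> w (-1)"
  by (simp_all add: v_def w_def)

lemma bar_fixed: "u \<in> F \<Longrightarrow> bar u \<in> F"
  unfolding fixed_points_iff bar_def by blast

section \<open>Blocks of higher level\<close>

lemma R_power_pos: "R ^ k > 0" using R_pos by simp

lemma fixed_power: "u \<in> F \<Longrightarrow> u (R ^ k * m) = u m"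
proof (induction k arbitrary: m)
  case (Suc k)
  then show ?case
    using fixed_digit[of u 0 "R ^ k * m"] R_pos c_first by (simp add: mult.assoc)
qed simp

lemma fixed_power_minus_1: "u \<in> F \<Longrightarrow> u (R ^ k * m - 1) = u (m - 1)"
proof (induction k arbitrary: m)
  case (Suc k)
  have eq: "R ^ Suc k * m - 1 = R * (R ^ k * m - 1) + (R - 1)" by (simp add: algebra_simps)
  have "u (R * (R ^ k * m - 1) + (R - 1)) = u (R ^ k * m - 1)"
    using fixed_digit[OF Suc.prems, of "R - 1" "R ^ k * m - 1"] R_pos c_last by simp
  then show ?case by (simp only: eq Suc.IH[OF Suc.prems])
qed simp

text \<open>Induction on \<open>k\<close>, dividing \<open>s\<close> by \<open>R\<close>. The
  equation of truth values says that block \<open>q\<close> of level \<open>k\<close> is the initial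
  segment of \<open>v\<close> if \<open>u q\<close> holds, and its complement otherwise.\<close>

lemma fixed_block:
  "u \<in> F \<Longrightarrow> 0 \<le> s \<Longrightarrow> s < R ^ k \<Longrightarrow> (u (R ^ k * q + s) = u q) = v s"
proof (induction k arbitrary: s)
  case 0
  then have "s = 0" by simp
  then show ?case using v_0 by simp
next
  case (Suc k)
  let ?s = "s div R" and ?t = "s mod R"
  have "R * ?s \<le> s" using R_pos mult_div_mod_eq[of R s] pos_mod_sign[of R s] by linarith
  then have "R * ?s < R * R ^ k" using Suc.prems(3) by simp
  then have s: "0 \<le> ?s" "?s < R ^ k"
    using Suc.prems(2) R_pos by (auto simp: pos_imp_zdiv_nonneg_iff)
  have "R ^ Suc k * q + s = R * (R ^ k * q + ?s) + ?t"
    by (simp add: algebra_simps)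
  then have "u (R ^ Suc k * q + s) = (u (R ^ k * q + ?s) \<noteq> c ?t)"
    using fixed_digit[OF Suc.prems(1), of ?t "R ^ k * q + ?s"] R_pos by simp
  moreover have "v s = (v ?s \<noteq> c ?t)"
    using v_fixed unfolding fixed_points_iff by blast
  ultimately show ?case using Suc.IH[OF Suc.prems(1) s] by auto
qed

text \<open>The two level-\<open>k\<close> blocks meeting at \<open>R ^ k * m\<close> are determined
  by the letters of \<open>u\<close> at \<open>m - 1\<close> and \<open>m\<close>, just as those of
  \<open>u'\<close> meeting at the origin are by its letters at \<open>-1\<close> and
  \<open>0\<close>.\<close>

lemma fixed_window:
  assumes u: "u \<in> F" "u' \<in> F" and eq: "u (m - 1) = u' (-1)" "u m = u' 0"
    and s: "- (R ^ k) \<le> s" "s < R ^ k"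
  shows "u (R ^ k * m + s) = u' s"
proof (cases "s \<ge> 0")
  case True
  then show ?thesis using fixed_block[OF u(1) _ s(2), of m] fixed_block[OF u(2) _ s(2), of 0] eq by auto
next
  case False
  then have s': "0 \<le> s + R ^ k" "s + R ^ k < R ^ k" using s by auto
  have "R ^ k * (m - 1) + (s + R ^ k) = R ^ k * m + s" "R ^ k * (-1) + (s + R ^ k) = s"
    by (simp_all add: algebra_simps)
  then have "(u (R ^ k * m + s) = u (m - 1)) = v (s + R ^ k)" "(u' s = u' (-1)) = v (s + R ^ k)"
    using fixed_block[OF u(1) s', of "m - 1"] fixed_block[OF u(2) s', of "-1"] by (simp_all only:)
  then show ?thesis using eq(1) by auto
qed

text \<open>
  The words cut at the positions \<open>b + R\<^sup>k \<int>\<close> into blocks \<open>\<theta>\<^sup>k(0)\<close> and \<open>\<theta>\<^sup>k(1)\<close>,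
  the latter being the initial segment of \<open>v\<close> of length \<open>R\<^sup>k\<close>.
\<close>

definition blocks :: "nat \<Rightarrow> int \<Rightarrow> biword set" where
  "blocks k b = {x. \<forall>q s. 0 \<le> s \<longrightarrow> s < R ^ k \<longrightarrow> (x (b + R ^ k * q + s) = x (b + R ^ k * q)) = v s}"

lemma blocksD:
  "x \<in> blocks k b \<Longrightarrow> 0 \<le> s \<Longrightarrow> s < R ^ k \<Longrightarrow> (x (b + R ^ k * q + s) = x (b + R ^ k * q)) = v s"
  by (simp add: blocks_def)

lemma blocks_translate:
  assumes "x \<in> blocks k b"
  shows "x \<in> blocks k (b + R ^ k * j)"
  unfolding blocks_def
proof (intro CollectI allI impI)
  fix q s :: int assume s: "0 \<le> s" "s < R ^ k"
  have eq: "b + R ^ k * j + R ^ k * q = b + R ^ k * (j + q)" by (simp add: algebra_simps)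
  show "(x (b + R ^ k * j + R ^ k * q + s) = x (b + R ^ k * j + R ^ k * q)) = v s"
    unfolding eq by (rule blocksD[OF assms s])
qed

lemma shift_mem_blocks_iff: "shift n x \<in> blocks k b \<longleftrightarrow> x \<in> blocks k (b + n)"
  by (simp add: blocks_def shift_def algebra_simps)

lemma fixed_mem_blocks: "u \<in> F \<Longrightarrow> u \<in> blocks k 0"
  by (simp add: blocks_def fixed_block fixed_power)

text \<open>A block of level \<open>k + 1\<close> is, up to complement, an initial segment of
  \<open>v\<close>, which is itself cut into blocks of level \<open>k\<close>.\<close>

lemma blocks_Suc:
  assumes x: "x \<in> blocks (Suc k) b"
  shows "x \<in> blocks k b"
  unfolding blocks_def
proof (intro CollectI allI impI)
  fix q s :: int assume s: "0 \<le> s" "s < R ^ k"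
  let ?q = "q div R" and ?t = "q mod R"
  have t: "0 \<le> ?t" "?t \<le> R - 1" using R_pos by simp_all
  have "R ^ k * ?t \<le> R ^ k * (R - 1)" using t R_power_pos[of k] by (intro mult_left_mono) auto
  then have ts: "0 \<le> R ^ k * ?t" "R ^ k * ?t + s < R ^ Suc k"
    using s t R_power_pos[of k] by (simp_all add: algebra_simps)
  have "R ^ k * q = R ^ k * (R * ?q + ?t)" by simp
  also have "\<dots> = R ^ Suc k * ?q + R ^ k * ?t"
    by (simp only: power_Suc distrib_left mult.assoc mult.left_commute[of "R ^ k" R])
  finally have q: "R ^ k * q = R ^ Suc k * ?q + R ^ k * ?t" .
  have "(v (R ^ k * ?t + s) = v (R ^ k * ?t)) = v s"
    using blocksD[OF fixed_mem_blocks[OF v_fixed, of k] s, of ?t] by simp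
  moreover have "(x (b + R ^ Suc k * ?q + (R ^ k * ?t + s)) = x (b + R ^ Suc k * ?q)) = v (R ^ k * ?t + s)"
    using ts s by (intro blocksD[OF x]) auto
  moreover have "(x (b + R ^ Suc k * ?q + R ^ k * ?t) = x (b + R ^ Suc k * ?q)) = v (R ^ k * ?t)"
    using ts s R_pos by (intro blocksD[OF x]) auto
  moreover have e: "b + R ^ k * q = b + R ^ Suc k * ?q + R ^ k * ?t"
    "b + R ^ k * q + s = b + R ^ Suc k * ?q + (R ^ k * ?t + s)" using q by simp_all
  ultimately show "(x (b + R ^ k * q + s) = x (b + R ^ k * q)) = v s"
    unfolding e(2) unfolding e(1) by blast
qed

lemma blocks_antimono: "k \<le> l \<Longrightarrow> x \<in> blocks l b \<Longrightarrow> x \<in> blocks k b"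
  by (induction l rule: dec_induct) (auto intro: blocks_Suc)

lemma less_R_power: "int k < R ^ k"
proof -
  have "int k < 2 ^ k" by (metis of_nat_less_two_power)
  also have "(2 :: int) ^ k \<le> R ^ k" using R_ge_3 by (intro power_mono) auto
  finally show ?thesis .
qed

text \<open>The blocks starting at \<open>0\<close> exhaust the nonnegative positions and those
  ending at \<open>-1\<close> the negative ones, so one letter determines each half.\<close>

lemma blocks_0_eqI:
  assumes x: "\<And>k. x \<in> blocks k 0" and y: "\<And>k. y \<in> blocks k 0"
    and eq: "x (-1) = y (-1)" "x 0 = y 0"
  shows "x = y"
proof
  fix n
  show "x n = y n"
  proof (cases "n \<ge> 0")
    case True
    then have "n < R ^ nat n" using less_R_power[of "nat n"] by simp
    then show ?thesis
      using blocksD[OF x, of n "nat n" 0] blocksD[OF y, of n "nat n" 0] True eq by auto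
  next
    case False
    define k where "k = nat (- n)"
    have n: "0 \<le> n + R ^ k" "n + R ^ k < R ^ k" using False less_R_power[of k] by (auto simp: k_def)
    \<comment> \<open>Block \<open>-1\<close> of level \<open>k\<close> starts at
      \<open>- (R ^ k)\<close> and ends at \<open>-1\<close>; both \<open>n\<close> and
      \<open>-1\<close> are compared with its first letter.\<close>
    have "(z n = z (- (R ^ k))) = v (n + R ^ k)" "(z (-1) = z (- (R ^ k))) = v (R ^ k - 1)"
      if "\<And>k. z \<in> blocks k 0" for z
      using blocksD[OF that, of "n + R ^ k" k "-1"] blocksD[OF that, of "R ^ k - 1" k "-1"]
        n R_power_pos[of k] by (simp_all add: algebra_simps)
    from this[OF x] this[OF y] eq show ?thesis by auto
  qed
qed

text \<open>Cuts at \<open>0\<close> on every level leave only the letters at \<open>-1\<close> and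
  \<open>0\<close> free, and \<open>digit_word\<close> realises each choice. Limits that preserve
  cuts thus map fixed points to fixed points.\<close>

lemma fixed_points_eq_blocks: "F = (\<Inter>k. blocks k 0)"
proof
  show "F \<subseteq> (\<Inter>k. blocks k 0)" using fixed_mem_blocks by blast
  show "(\<Inter>k. blocks k 0) \<subseteq> F"
  proof
    fix x assume x: "x \<in> (\<Inter>k. blocks k 0)"
    have "x = digit_word R c (x (-1)) (x 0)"
      by (rule blocks_0_eqI) (use x fixed_mem_blocks[OF digit_word_fixed] in auto)
    then show "x \<in> F" using digit_word_fixed by metis
  qed
qed

lemma fixed_eqI: "u \<in> F \<Longrightarrow> u' \<in> F \<Longrightarrow> u (-1) = u' (-1) \<Longrightarrow> u 0 = u' 0 \<Longrightarrow> u = u'"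
  by (rule blocks_0_eqI) (auto intro: fixed_mem_blocks)

lemma fixed_points_eq: "F = {v, bar v, w, bar w}"
proof
  show "F \<subseteq> {v, bar v, w, bar w}"
  proof
    fix u assume u: "u \<in> F"
    consider "u (-1) = v (-1)" "u 0 = v 0" | "u (-1) = bar v (-1)" "u 0 = bar v 0"
      | "u (-1) = w (-1)" "u 0 = w 0" | "u (-1) = bar w (-1)" "u 0 = bar w 0"
      using v_0 v_minus_1 w_0 w_minus_1 by (auto simp: bar_def)
    then show "u \<in> {v, bar v, w, bar w}"
      by cases (use fixed_eqI[OF u] v_fixed w_fixed bar_fixed in blast)+
  qed
qed (use v_fixed w_fixed bar_fixed in auto)

section \<open>Relations between the four fixed points\<close>

lemma bar_bar [simp]: "bar (bar x) = x" by (simp add: bar_def)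

lemma bar_neq [simp]: "bar x \<noteq> x" "x \<noteq> bar x"
  by (auto simp: bar_def fun_eq_iff)

lemma bar_eq_iff [simp]: "bar x = bar y \<longleftrightarrow> x = y"
  by (auto simp: bar_def fun_eq_iff)

lemma v_neq_w [simp]: "v \<noteq> w" "w \<noteq> v" "v \<noteq> bar w" "bar w \<noteq> v" "bar v \<noteq> w" "w \<noteq> bar v"
proof -
  show "v \<noteq> w" "w \<noteq> v" using v_minus_1 w_minus_1 by auto
  have "v 0 \<noteq> bar w 0" "bar v 0 \<noteq> w 0" using v_0 w_0 by (auto simp: bar_def)
  then show "v \<noteq> bar w" "bar w \<noteq> v" "bar v \<noteq> w" "w \<noteq> bar v" by metis+
qed

lemma v_eq_w_nonneg:
  assumes "n \<ge> 0" shows "v n = w n"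
proof -
  have "n < R ^ nat n" using less_R_power[of "nat n"] assms by simp
  then show ?thesis using fixed_block[OF w_fixed, of n "nat n" 0] w_0 assms by simp
qed

lemma v_eq_not_w_neg:
  assumes "n < 0" shows "v n = (\<not> w n)"
proof -
  define k where "k = nat (- n)"
  have n: "0 \<le> n + R ^ k" "n + R ^ k < R ^ k" using assms less_R_power[of k] by (auto simp: k_def)
  show ?thesis
    using fixed_block[OF w_fixed n, of "-1"] fixed_block[OF v_fixed n, of "-1"] v_minus_1 w_minus_1
    by simp
qed

section \<open>Occurrences of two-letter words\<close>

lemma switch_digits:
  assumes "i \<le> j" "c i \<noteq> c j"
  shows "\<exists>m. i \<le> m \<and> m < j \<and> c m = c i \<and> c (m + 1) \<noteq> c i"
proof (rule ccontr)
  assume "\<not> ?thesis"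
  then have step: "c (m + 1) = c i" if "i \<le> m" "m < j" "c m = c i" for m
    using that by blast
  have "m \<le> j \<longrightarrow> c m = c i" if "i \<le> m" for m
    using that by (induction m rule: int_ge_induct) (use step in auto)
  then show False using assms by blast
qed

text \<open>Otherwise \<open>c\<close> is parity and \<open>R\<close> is odd, so the alternating
  word is a fixed point of period 2.\<close>

lemma ex_equal_digits: "\<exists>i. 0 \<le> i \<and> i < R - 1 \<and> c i = c (i + 1)"
proof (rule ccontr)
  assume "\<not> ?thesis"
  then have alt: "c (i + 1) = (\<not> c i)" if "0 \<le> i" "i < R - 1" for i
    using that by auto
  have odd: "i < R \<longrightarrow> c i = odd i" if "0 \<le> i" for i
    using that by (induction i rule: int_ge_induct) (use alt c_first in auto)
  have "even (R - 1)" using odd[of "R - 1"] c_last R_pos by simp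
  then have "odd n = (odd (n div R) \<noteq> odd (n mod R))" for n
    using mult_div_mod_eq[of R n] by (metis even_add even_mult_iff odd_one even_diff)
  moreover have "c (n mod R) = odd (n mod R)" for n using odd[of "n mod R"] R_pos by simp
  ultimately have "odd \<in> F" unfolding fixed_points_iff by blast
  moreover have "shift_periodic odd"
    unfolding shift_periodic_def by (intro exI[of _ 2]) (simp add: shift_def fun_eq_iff)
  ultimately show False using fixed_not_periodic by blast
qed

text \<open>The word is found inside block \<open>N\<close> of level 1 or 2, so \<open>N = 0\<close>
  keeps it to the right of the origin and \<open>N = -1\<close> to the left.\<close>

lemma two_letter_word_in_block:
  assumes u: "u \<in> F"
  shows "\<exists>n i. 0 \<le> i \<and> i < R - 1 \<and> (n = N \<or> R * N < n \<and> n < R * N + R - 1) \<and>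
    u (R * n + i) = a \<and> u (R * n + i + 1) = b"
proof -
  obtain j where j: "0 < j" "j < R - 1" "c j" using ex_digit by blast
  have i: "u (R * n + i) = (u n \<noteq> c i)" "u (R * n + i + 1) = (u n \<noteq> c (i + 1))"
    if "0 \<le> i" "i < R - 1" for n i
    using fixed_digit[OF u, of i n] fixed_digit[OF u, of "i + 1" n] that by (simp_all add: add.assoc)
  show ?thesis
  proof (cases "a = b")
    case True
    obtain i where I: "0 \<le> i" "i < R - 1" "c i = c (i + 1)" using ex_equal_digits by blast
    \<comment> \<open>The letters at \<open>N\<close> and \<open>R * N + j\<close> differ, so one of
      the two blocks turns the repeated digit into \<open>a\<close>.\<close>
    have "u (R * N + j) = (\<not> u N)" using i(1)[of j N] j by simp
    then obtain n where "n = N \<or> n = R * N + j" "u n = (a \<noteq> c i)" by (metis (full_types))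
    then show ?thesis using i[OF I(1,2), of n] True I j by (intro exI[of _ n] exI[of _ i]) auto
  next
    case False
    \<comment> \<open>The digits rise between \<open>0\<close> and \<open>j\<close> and fall between
      \<open>j\<close> and \<open>R - 1\<close>, so both kinds of change occur.\<close>
    have "\<exists>m. 0 \<le> m \<and> m < R - 1 \<and> c m = d \<and> c (m + 1) \<noteq> d" for d
    proof (cases d)
      case True
      then show ?thesis using switch_digits[of j "R - 1"] j c_last by fastforce
    next
      case False
      then show ?thesis using switch_digits[of 0 j] j c_first by fastforce
    qed
    then obtain m where "0 \<le> m" "m < R - 1" "c m = (u N \<noteq> a)" "c (m + 1) \<noteq> (u N \<noteq> a)" by metis
    then show ?thesis using i[of m N] False by (intro exI[of _ N] exI[of _ m]) auto
  qed
qed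

lemma two_letter_word_right:
  assumes "u \<in> F" shows "\<exists>m>0. u (m - 1) = a \<and> u m = b"
proof -
  obtain n i where *: "0 \<le> i" "i < R - 1" "n = 0 \<or> 0 < n \<and> n < R - 1"
      "u (R * n + i) = a" "u (R * n + i + 1) = b"
    using two_letter_word_in_block[OF assms, of 0 a b] by auto
  then have "0 \<le> R * n" using R_pos by auto
  then show ?thesis using * by (intro exI[of _ "R * n + i + 1"]) auto
qed

lemma two_letter_word_left:
  assumes "u \<in> F" shows "\<exists>m<0. u (m - 1) = a \<and> u m = b"
proof -
  obtain n i where *: "0 \<le> i" "i < R - 1" "n = -1 \<or> - R < n \<and> n < -1"
      "u (R * n + i) = a" "u (R * n + i + 1) = b"
    using two_letter_word_in_block[OF assms, of "-1" a b] by auto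
  \<comment> \<open>Together with \<open>i < R - 1\<close> this gives
    \<open>R * n + i + 1 \<le> -1\<close>.\<close>
  then have "R * n \<le> R * (-1)" using R_pos by (intro mult_left_mono) auto
  then show ?thesis using * by (intro exI[of _ "R * n + i + 1"]) auto
qed

end

subsection \<open>The Ellis semigroup of the substitution shift\<close>

lemma mem_orbit_closure_iff:
  "x \<in> closure (shift_orbit u) \<longleftrightarrow> (\<forall>D. finite D \<longrightarrow> (\<exists>n. \<forall>i\<in>D. u (i + n) = x i))"
  by (simp add: closure_fun_discrete_iff shift_orbit_def shift_def)

lemma orbit_closure_trans:
  assumes x: "x \<in> closure (shift_orbit u)" and y: "y \<in> closure (shift_orbit x)"
  shows "y \<in> closure (shift_orbit u)"
  unfolding mem_orbit_closure_iff
proof (intro allI impI)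
  fix D :: "int set" assume D: "finite D"
  obtain n where n: "\<forall>i\<in>D. x (i + n) = y i"
    using y D unfolding mem_orbit_closure_iff by blast
  obtain m where "\<forall>i\<in>(\<lambda>i. i + n) ` D. u (i + m) = x i"
    using x D unfolding mem_orbit_closure_iff by blast
  then show "\<exists>k. \<forall>i\<in>D. u (i + k) = y i"
    using n by (intro exI[of _ "n + m"]) (simp add: add.assoc)
qed

lemma shift_mem_orbit_closure:
  "x \<in> closure (shift_orbit u) \<Longrightarrow> shift n x \<in> closure (shift_orbit u)"
  by (erule orbit_closure_trans) (auto simp: shift_orbit_def intro!: subsetD[OF closure_subset])

lemma bar_mem_orbit_closure:
  "x \<in> closure (shift_orbit u) \<Longrightarrow> bar x \<in> closure (shift_orbit (bar u))"
  unfolding mem_orbit_closure_iff bar_def by simp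

context canonical_substitution
begin

abbreviation X :: "biword set" where "X \<equiv> subst_shift \<theta>"

text \<open>The two letters of \<open>u'\<close> around the origin occur in \<open>u\<close> at some
  \<open>m\<close>; magnified by \<open>R ^ k\<close>, this occurrence shows arbitrarily long
  central pieces of \<open>u'\<close> in \<open>u\<close>.\<close>

lemma fixed_mem_orbit_closure:
  assumes u: "u \<in> F" "u' \<in> F"
  shows "u' \<in> closure (shift_orbit u)"
  unfolding mem_orbit_closure_iff
proof (intro allI impI)
  fix D :: "int set" assume D: "finite D"
  \<comment> \<open>A crude bound for all positions in \<open>D\<close>, hence below
    \<open>R ^ k\<close>.\<close>
  define k where "k = nat (\<Sum>i\<in>D. \<bar>i\<bar>)"
  have k: "- (R ^ k) \<le> i \<and> i < R ^ k" if "i \<in> D" for i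
  proof -
    have "\<bar>i\<bar> \<le> (\<Sum>i\<in>D. \<bar>i\<bar>)" using D that by (intro member_le_sum) auto
    then have "\<bar>i\<bar> \<le> int k" by (simp add: k_def)
    then show ?thesis using less_R_power[of k] by linarith
  qed
  obtain m where m: "u (m - 1) = u' (-1)" "u m = u' 0" using two_letter_word_right[OF u(1)] by blast
  have "u (i + R ^ k * m) = u' i" if "i \<in> D" for i
    using fixed_window[OF u m] k[OF that] by (simp add: add.commute)
  then show "\<exists>n. \<forall>i\<in>D. u (i + n) = u' i" by blast
qed

text \<open>Justifies the definite description: fixed points lie in the orbit closures of each
  other.\<close>

lemma subst_shift_eq:
  assumes u: "u \<in> F" shows "X = closure (shift_orbit u)"
  unfolding subst_shift_def
proof (rule the_equality)
  show "\<exists>u'\<in>F. closure (shift_orbit u) = closure (shift_orbit u')" using u by blast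
  fix Y assume "\<exists>u'\<in>F. Y = closure (shift_orbit u')"
  then obtain u' where u': "u' \<in> F" "Y = closure (shift_orbit u')" by blast
  then show "Y = closure (shift_orbit u)"
    using orbit_closure_trans fixed_mem_orbit_closure[OF u u'(1)] fixed_mem_orbit_closure[OF u'(1) u]
    by blast
qed

lemma fixed_mem [simp]: "u \<in> F \<Longrightarrow> u \<in> X"
  using subst_shift_eq[OF v_fixed] fixed_mem_orbit_closure[OF v_fixed] by blast

lemma shift_mem [simp]: "x \<in> X \<Longrightarrow> shift n x \<in> X"
  using shift_mem_orbit_closure subst_shift_eq[OF v_fixed] by simp

lemma bar_mem [simp]: "x \<in> X \<Longrightarrow> bar x \<in> X"
  using bar_mem_orbit_closure[of x v] subst_shift_eq[OF v_fixed] subst_shift_eq[OF bar_fixed[OF v_fixed]]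
  by simp

lemma closed_subst_shift: "closed X"
  using subst_shift_eq[OF v_fixed] by simp

text \<open>Only finitely many offsets modulo \<open>R ^ k\<close> compete. If all failed, one
  violation for each would be seen in a finite window, which some shift of \<open>v\<close> copies
  although it is cut at one of these offsets.\<close>

lemma ex_blocks:
  assumes x: "x \<in> X" shows "\<exists>b. x \<in> blocks k b"
proof (rule ccontr)
  assume "\<not> ?thesis"
  then have "\<forall>b. \<exists>q s. 0 \<le> s \<and> s < R ^ k \<and> (x (b + R ^ k * q + s) = x (b + R ^ k * q)) \<noteq> v s"
    unfolding blocks_def by blast
  then obtain q s where qs: "\<And>b. 0 \<le> s b" "\<And>b. s b < R ^ k"
      "\<And>b. (x (b + R ^ k * q b + s b) = x (b + R ^ k * q b)) \<noteq> v (s b)"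
    by metis
  let ?D = "(\<Union>b\<in>{0..<R ^ k}. {b + R ^ k * q b + s b, b + R ^ k * q b})"
  have xv: "x \<in> closure (shift_orbit v)" using x subst_shift_eq[OF v_fixed] by simp
  have "finite ?D" by simp
  then have "\<exists>n. \<forall>i\<in>?D. v (i + n) = x i"
    by (rule xv[unfolded mem_orbit_closure_iff, THEN spec, THEN mp])
  then obtain n where n: "\<forall>i\<in>?D. v (i + n) = x i" ..
  \<comment> \<open>Chosen so that \<open>R ^ k\<close> divides \<open>b + n\<close>, which makes
    \<open>b\<close> a cut of \<open>shift n v\<close>.\<close>
  define b where "b = (- n) mod R ^ k"
  have b: "b \<in> {0..<R ^ k}" using R_power_pos[of k] by (simp add: b_def)
  have "b = 0 + R ^ k * (- ((- n) div R ^ k)) + - n"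
    unfolding b_def minus_div_mult_eq_mod[symmetric] by (simp add: algebra_simps)
  then have "b + n = 0 + R ^ k * (- ((- n) div R ^ k))" by simp
  then have "shift n v \<in> blocks k b"
    unfolding shift_mem_blocks_iff by (metis blocks_translate fixed_mem_blocks v_fixed)
  from blocksD[OF this qs(1,2)[of b], of "q b"]
  have "(v (b + R ^ k * q b + s b + n) = v (b + R ^ k * q b + n)) = v (s b)"
    by (simp only: shift_def)
  moreover have "v (b + R ^ k * q b + s b + n) = x (b + R ^ k * q b + s b)"
    "v (b + R ^ k * q b + n) = x (b + R ^ k * q b)" using n b by blast+
  ultimately show False using qs(3)[of b] by simp
qed

section \<open>Symmetries of the Ellis semigroup and limits preserving all cuts\<close>

abbreviation E :: "(biword \<Rightarrow> biword) set" where "E \<equiv> ellis_semigroup X"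

lemma E_eq: "E = shift_limits X UNIV"
  by (rule ellis_semigroup_eq_shift_limits) simp

lemma shift_limits_subset_E: "f \<in> shift_limits X S \<Longrightarrow> f \<in> E"
  unfolding E_eq by (rule shift_limits_mono[of S]) auto

lemma E_mem: "f \<in> E \<Longrightarrow> x \<in> X \<Longrightarrow> f x \<in> X"
  unfolding E_eq by (rule shift_limits_mem)

lemma E_shift: "f \<in> E \<Longrightarrow> x \<in> X \<Longrightarrow> f (shift n x) = shift n (f x)"
  unfolding E_eq by (rule shift_limits_shift) auto

lemma E_bar: "f \<in> E \<Longrightarrow> x \<in> X \<Longrightarrow> f (bar x) = bar (f x)"
  unfolding E_eq by (rule shift_limits_bar) auto

lemma E_compose: "f \<in> E \<Longrightarrow> g \<in> E \<Longrightarrow> compose X f g \<in> E"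
  unfolding E_eq by (rule shift_limits_compose) auto

text \<open>The elements of the Ellis semigroup acting as translation by \<open>0\<close> on the \<open>R\<close>-adic integers.\<close>

definition E0 :: "(biword \<Rightarrow> biword) set" where "E0 = (\<Inter>k. shift_limits X {n. R ^ k dvd n})"

lemma E0D: "f \<in> E0 \<Longrightarrow> f \<in> shift_limits X {n. R ^ k dvd n}"
  by (simp add: E0_def)

lemma E0_subset_E: "f \<in> E0 \<Longrightarrow> f \<in> E"
  using E0D shift_limits_subset_E by blast

lemma E0_compose:
  assumes "f \<in> E0" "g \<in> E0" shows "compose X f g \<in> E0"
  unfolding E0_def
proof
  fix k
  show "compose X f g \<in> shift_limits X {n. R ^ k dvd n}"
    by (rule shift_limits_compose[OF E0D[OF assms(1), of k] E0D[OF assms(2), of k]]) auto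
qed

lemma E0_blocks:
  assumes f: "f \<in> E0" and x: "x \<in> X" "x \<in> blocks k b"
  shows "f x \<in> blocks k b"
  unfolding blocks_def
proof (intro CollectI allI impI)
  fix q s :: int assume s: "0 \<le> s" "s < R ^ k"
  obtain n where n: "n \<in> {n. R ^ k dvd n}"
      "\<And>i. i \<in> {b + R ^ k * q + s, b + R ^ k * q} \<Longrightarrow> f x i = x (i + n)"
    using shift_limits_witness_1[OF E0D[OF f] x(1), of "{b + R ^ k * q + s, b + R ^ k * q}" k] by blast
  then obtain m where m: "n = R ^ k * m" by auto
  have "b + R ^ k * q + s + n = b + R ^ k * (q + m) + s" "b + R ^ k * q + n = b + R ^ k * (q + m)"
    by (simp_all add: m algebra_simps)
  then have "f x (b + R ^ k * q + s) = x (b + R ^ k * (q + m) + s)"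
      "f x (b + R ^ k * q) = x (b + R ^ k * (q + m))"
    using n(2) by (metis insertCI)+
  then show "(f x (b + R ^ k * q + s) = f x (b + R ^ k * q)) = v s"
    using blocksD[OF x(2) s, of "q + m"] by blast
qed

text \<open>\<open>x\<close> and \<open>f x\<close> have the same cuts, so on each block they are
  equal or complementary.\<close>

lemma E0_agree_on_block:
  assumes f: "f \<in> E0" and x: "x \<in> X" "x \<in> blocks k b" and s: "0 \<le> s" "s < R ^ k"
  shows "f x (b + s) = x (b + s) \<longleftrightarrow> f x b = x b"
proof -
  have "x (b + s) = x b \<longleftrightarrow> v s" using blocksD[OF x(2) s, of 0] by simp
  moreover have "f x (b + s) = f x b \<longleftrightarrow> v s" using blocksD[OF E0_blocks[OF f x] s, of 0] by simp
  ultimately show ?thesis by blast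
qed

lemma E0_fixed:
  assumes "f \<in> E0" "u \<in> F" shows "f u \<in> F"
proof -
  have "f u \<in> blocks k 0" for k
    by (rule E0_blocks[OF assms(1) fixed_mem[OF assms(2)] fixed_mem_blocks[OF assms(2)]])
  then show ?thesis by (simp add: fixed_points_eq_blocks)
qed

abbreviation off_orbits :: "biword set" where "off_orbits \<equiv> X - (\<Union>u\<in>F. shift_orbit u)"

lemma E0_off_orbits:
  assumes f: "f \<in> E0" and x: "x \<in> off_orbits"
  shows "f x = x \<or> f x = bar x"
proof (rule ccontr)
  assume *: "\<not> ?thesis"
  have xX: "x \<in> X" using x by blast
  obtain i j where ij: "f x i \<noteq> x i" "f x j = x j"
    using * unfolding fun_eq_iff bar_def by auto
  define lo hi where "lo = min i j" and "hi = max i j"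
  have lohi: "(f x lo = x lo) \<noteq> (f x hi = x hi)" "lo \<le> hi"
    using ij by (auto simp: lo_def hi_def min_def max_def)
  have B: "\<exists>B. lo < B \<and> B \<le> hi \<and> x \<in> blocks k B" for k
  proof -
    obtain b where b: "x \<in> blocks k b" using ex_blocks[OF xX] by blast
    \<comment> \<open>The last cut at or before \<open>lo\<close>. Its block cannot reach
      \<open>hi\<close>, as agreement is constant on blocks, so the next cut lies in
      \<open>{lo<..hi}\<close>.\<close>
    define b' where "b' = b + R ^ k * ((lo - b) div R ^ k)"
    have b': "x \<in> blocks k b'" using blocks_translate[OF b] by (simp add: b'_def)
    have "lo - b' = (lo - b) mod R ^ k"
      by (simp add: b'_def minus_mult_div_eq_mod[symmetric] algebra_simps)
    then have l: "0 \<le> lo - b'" "lo - b' < R ^ k" using R_power_pos[of k] by simp_all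
    have "\<not> hi - b' < R ^ k"
      using lohi E0_agree_on_block[OF f xX b' l] E0_agree_on_block[OF f xX b', of "hi - b'"] l(1) by auto
    then show ?thesis
      using l blocks_translate[OF b', of 1] by (intro exI[of _ "b' + R ^ k"]) auto
  qed
  \<comment> \<open>A block boundary separates \<open>lo\<close> from \<open>hi\<close> at every level; by finiteness one of them serves all
      levels, and the word recentred there is a fixed point.\<close>
  have "\<exists>B. \<forall>k. x \<in> blocks k B"
  proof (rule ccontr)
    assume "\<not> ?thesis"
    then obtain kk where kk: "\<And>B. x \<notin> blocks (kk B) B" by metis
    \<comment> \<open>Cuts of a higher level are cuts of all lower levels, so every candidate
      already fails at level \<open>K\<close>.\<close>
    define K where "K = (\<Sum>B\<in>{lo<..hi}. kk B)"
    obtain B where B: "lo < B" "B \<le> hi" "x \<in> blocks K B" using B by blast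
    have "kk B \<le> K" unfolding K_def using B by (intro member_le_sum) auto
    then show False using kk blocks_antimono B(3) by blast
  qed
  then obtain B where "\<And>k. x \<in> blocks k B" by blast
  then have "shift B x \<in> F" by (simp add: fixed_points_eq_blocks shift_mem_blocks_iff)
  moreover have "x = shift (- B) (shift B x)" by (simp add: shift_def)
  ultimately show False using x unfolding shift_orbit_def by blast
qed

lemma E0_square_off_orbits:
  assumes f: "f \<in> E0" and x: "x \<in> off_orbits"
  shows "f (f x) = x"
  using E0_off_orbits[OF f x] E_bar[OF E0_subset_E[OF f], of x] x by auto

text \<open>Complement carries the values at \<open>v\<close> and \<open>w\<close> to all four fixed
  points, and the shift carries these to the orbits.\<close>

lemma E_eqI:
  assumes f: "f \<in> E" and g: "g \<in> E" and eq: "f v = g v" "f w = g w"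
    and off: "\<And>x. x \<in> off_orbits \<Longrightarrow> f x = g x"
  shows "f = g"
proof (rule PiE_ext)
  show "f \<in> X \<rightarrow>\<^sub>E X" "g \<in> X \<rightarrow>\<^sub>E X" using f g shift_limits_PiE unfolding E_eq by blast+
  have F: "f u = g u" if "u \<in> F" for u
    using that eq E_bar[OF f fixed_mem[OF v_fixed]] E_bar[OF g fixed_mem[OF v_fixed]]
      E_bar[OF f fixed_mem[OF w_fixed]] E_bar[OF g fixed_mem[OF w_fixed]]
    unfolding fixed_points_eq by auto
  fix x assume x: "x \<in> X"
  show "f x = g x"
  proof (cases "x \<in> off_orbits")
    case False
    then obtain u n where u: "u \<in> F" "x = shift n u" using x by (auto simp: shift_orbit_def)
    then show ?thesis using F E_shift[OF f] E_shift[OF g] by simp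
  qed (rule off)
qed

section \<open>Elements with prescribed values at the fixed points\<close>

lemma ex_E0_at:
  "\<exists>h\<in>E0. \<forall>u\<in>F. h u (-1) = u (m - 1) \<and> h u 0 = u m"
proof -
  \<comment> \<open>The letters of a fixed point at \<open>R ^ k * m - 1\<close> and
    \<open>R ^ k * m\<close> do not depend on \<open>k\<close>, so a cluster point of these shifts
    reads them off, for all fixed points at once.\<close>
  obtain h where h: "\<And>k. h \<in> shift_limits X ((\<lambda>k. R ^ k * m) ` {k..})"
    using shift_limits_cluster_point[OF closed_subst_shift shift_mem, of "\<lambda>k. R ^ k * m"] by blast
  have "(\<lambda>k. R ^ k * m) ` {k..} \<subseteq> {n. R ^ k dvd n}" for k
    by (auto intro: dvd_mult2 le_imp_power_dvd)
  then have "h \<in> E0" using h shift_limits_mono unfolding E0_def by blast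
  moreover have "h u (-1) = u (m - 1) \<and> h u 0 = u m" if u: "u \<in> F" for u
  proof -
    obtain n where n: "n \<in> (\<lambda>k. R ^ k * m) ` {0..}" "\<And>i. i \<in> {-1, 0} \<Longrightarrow> h u i = u (i + n)"
      using shift_limits_witness_1[OF h fixed_mem[OF u], of "{-1, 0}" 0] by blast
    then obtain l where l: "n = R ^ l * m" by auto
    show ?thesis
      using n(2)[of "-1"] n(2)[of 0] fixed_power[OF u, of l m] fixed_power_minus_1[OF u, of l m]
      by (simp add: l)
  qed
  ultimately show ?thesis by blast
qed

lemma ex_E0_right:
  assumes t: "t \<in> F"
  shows "\<exists>h\<in>E0. h v = t \<and> h w = t"
proof -
  obtain m where m: "m > 0" "v (m - 1) = t (-1)" "v m = t 0"
    using two_letter_word_right[OF v_fixed] by blast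
  obtain h where h: "h \<in> E0" "\<And>u. u \<in> F \<Longrightarrow> h u (-1) = u (m - 1)" "\<And>u. u \<in> F \<Longrightarrow> h u 0 = u m"
    using ex_E0_at[of m] by blast
  have "w (m - 1) = v (m - 1)" "w m = v m" using v_eq_w_nonneg m(1) by auto
  then have "h v = t" "h w = t"
    using fixed_eqI[OF E0_fixed[OF h(1) v_fixed] t] fixed_eqI[OF E0_fixed[OF h(1) w_fixed] t]
      h(2,3)[OF v_fixed] h(2,3)[OF w_fixed] m by auto
  then show ?thesis using h(1) by blast
qed

lemma ex_E0_left:
  assumes t: "t \<in> F"
  shows "\<exists>h\<in>E0. h v = t \<and> h w = bar t"
proof -
  obtain m where m: "m < 0" "v (m - 1) = t (-1)" "v m = t 0"
    using two_letter_word_left[OF v_fixed] by blast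
  obtain h where h: "h \<in> E0" "\<And>u. u \<in> F \<Longrightarrow> h u (-1) = u (m - 1)" "\<And>u. u \<in> F \<Longrightarrow> h u 0 = u m"
    using ex_E0_at[of m] by blast
  have "w (m - 1) = bar v (m - 1)" "w m = bar v m"
    using v_eq_not_w_neg[of m] v_eq_not_w_neg[of "m - 1"] m(1) by (auto simp: bar_def)
  then have "h v = t" "h w = bar t"
    using fixed_eqI[OF E0_fixed[OF h(1) v_fixed] t]
      fixed_eqI[OF E0_fixed[OF h(1) w_fixed] bar_fixed[OF t]]
      h(2,3)[OF v_fixed] h(2,3)[OF w_fixed] m by (auto simp: bar_def)
  then show ?thesis using h(1) by blast
qed

section \<open>Residues modulo powers of \<open>R\<close>\<close>

lemma E_residue:
  assumes "f \<in> E" shows "\<exists>j. f \<in> shift_limits X {n. R ^ k dvd n - j}"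
proof -
  have "n \<in> (\<Union>j\<in>{0..<R ^ k}. {n. R ^ k dvd n - j})" for n
    using R_power_pos[of k] by (intro UN_I[of "n mod R ^ k"]) (auto simp: dvd_minus_mod)
  then have "(\<Union>j\<in>{0..<R ^ k}. {n. R ^ k dvd n - j}) = UNIV" by blast
  then show ?thesis
    using shift_limits_UN[of f X "\<lambda>j. {n. R ^ k dvd n - j}" "{0..<R ^ k}"] assms E_eq by auto
qed

text \<open>If \<open>e\<close> has residue \<open>j\<close> modulo \<open>R\<^sup>k\<close>, then \<open>e = e\<^sup>n\<close> with \<open>n = R\<^sup>k\<close> has residue \<open>0\<close>.\<close>

lemma idempotent_mem_E0:
  assumes e: "e \<in> E" "compose X e e = e"
  shows "e \<in> E0"
proof -
  have "e \<in> shift_limits X {n. R ^ k dvd n}" for k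
  proof -
    obtain j where j: "e \<in> shift_limits X {n. R ^ k dvd n - j}" using E_residue[OF e(1)] by blast
    have pow: "e \<in> shift_limits X {n. R ^ k dvd n - int (Suc l) * j}" for l
    proof (induction l)
      case (Suc l)
      have "compose X e e \<in> shift_limits X {n. R ^ k dvd n - int (Suc (Suc l)) * j}"
      proof (rule shift_limits_compose[OF j Suc])
        fix m n assume "m \<in> {n. R ^ k dvd n - j}" "n \<in> {n. R ^ k dvd n - int (Suc l) * j}"
        then have "R ^ k dvd (m - j) + (n - int (Suc l) * j)" by (intro dvd_add) auto
        then show "m + n \<in> {n. R ^ k dvd n - int (Suc (Suc l)) * j}" by (simp add: algebra_simps)
      qed
      then show ?case by (simp only: e(2))
    qed (use j in simp)
    have "int (Suc (nat (R ^ k - 1))) = R ^ k" using R_power_pos[of k] by simp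
    then have "e \<in> shift_limits X {n. R ^ k dvd n - R ^ k * j}"
      using pow[of "nat (R ^ k - 1)"] by (simp only:)
    moreover have "{n. R ^ k dvd n - R ^ k * j} \<subseteq> {n. R ^ k dvd n}"
      using dvd_add[of "R ^ k" _ "R ^ k * j"] by fastforce
    ultimately show ?thesis using shift_limits_mono by blast
  qed
  then show ?thesis by (simp add: E0_def)
qed

text \<open>A cluster point of the negated residues cancels the translation part of
  \<open>f\<close>. Hence every left ideal meets \<open>E0\<close>.\<close>

lemma ex_left_multiple_in_E0:
  assumes f: "f \<in> E" shows "\<exists>h\<in>E. compose X h f \<in> E0"
proof -
  obtain j where j: "\<And>k. f \<in> shift_limits X {n. R ^ k dvd n - j k}"
    using E_residue[OF f] by metis
  obtain h where h: "\<And>k. h \<in> shift_limits X ((\<lambda>k. - j k) ` {k..})"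
    using shift_limits_cluster_point[OF closed_subst_shift shift_mem, of "\<lambda>k. - j k"] by blast
  have "compose X h f \<in> shift_limits X {n. R ^ k dvd n}" for k
  proof (rule shift_limits_compose_dependent[OF h[of k]])
    show "f \<in> X \<rightarrow>\<^sub>E X" using shift_limits_PiE[OF j] .
    fix m assume "m \<in> (\<lambda>k. - j k) ` {k..}"
    then obtain l where l: "l \<ge> k" "m = - j l" by auto
    \<comment> \<open>The shift \<open>m\<close> comes from level \<open>l\<close>, so
      \<open>f\<close> is approximated at that level; divisibility by \<open>R ^ l\<close> implies
      divisibility by \<open>R ^ k\<close>.\<close>
    have "{n. R ^ l dvd n - j l} \<subseteq> {n. R ^ k dvd m + n}"
      using l by (auto intro: dvd_trans[OF le_imp_power_dvd])
    then show "f \<in> shift_limits X {n. R ^ k dvd m + n}" using j[of l] shift_limits_mono by blast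
  qed simp
  then show ?thesis using shift_limits_subset_E[OF h] by (auto simp: E0_def)
qed

subsection \<open>Idempotents and minimal ideals\<close>

lemma v_mem: "v \<in> X" and w_mem: "w \<in> X"
  using v_fixed w_fixed by simp_all

lemmas E_bar_v = E_bar[OF _ v_mem] and E_bar_w = E_bar[OF _ w_mem]

text \<open>A row of the shorthand table; the values at \<open>bar v\<close> and
  \<open>bar w\<close> follow because \<open>g\<close> commutes with \<open>bar\<close>.\<close>

definition table :: "(biword \<Rightarrow> biword) \<Rightarrow> biword \<Rightarrow> biword \<Rightarrow> bool" where
  "table g a b \<longleftrightarrow> g \<in> E0 \<and> g v = a \<and> g w = b \<and> (\<forall>x\<in>off_orbits. g x = x)"

lemma table_square: "h \<in> E0 \<Longrightarrow> table (compose X h h) (h (h v)) (h (h w))"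
  using E0_compose[of h h] E0_square_off_orbits[of h] v_mem w_mem
  by (simp add: table_def compose_eq)

lemma table_unique: "table g a b \<Longrightarrow> table g' a b \<Longrightarrow> g = g'"
  unfolding table_def by (rule E_eqI) (auto intro: E0_subset_E)

lemma table_E: "table g a b \<Longrightarrow> g \<in> E"
  by (simp add: table_def E0_subset_E)

lemma idempotent_table:
  assumes e: "e \<in> E" "compose X e e = e"
  shows "table e (e v) (e w)"
proof -
  have "e (e x) = e x" if "x \<in> X" for x using e(2) compose_eq[OF that, of e e] by simp
  then show ?thesis
    using E0_square_off_orbits[OF idempotent_mem_E0[OF e]] idempotent_mem_E0[OF e]
    by (auto simp: table_def)
qed

lemma ex_g1: "\<exists>g. table g w w"
proof -
  obtain h where "h \<in> E0" "h v = w" "h w = w" using ex_E0_right[OF w_fixed] by blast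
  then show ?thesis using table_square[of h] by auto
qed

lemma ex_g2: "\<exists>g. table g (bar w) w"
proof -
  obtain h where "h \<in> E0" "h v = bar w" "h w = w"
    using ex_E0_left[OF bar_fixed[OF w_fixed]] by auto
  then show ?thesis using table_square[of h] E_bar_w[OF E0_subset_E, of h] by auto
qed

lemma ex_g3: "\<exists>g. table g v v"
proof -
  obtain h where "h \<in> E0" "h v = v" "h w = v" using ex_E0_right[OF v_fixed] by blast
  then show ?thesis using table_square[of h] by auto
qed

lemma ex_g4: "\<exists>g. table g v (bar v)"
proof -
  obtain h where "h \<in> E0" "h v = v" "h w = bar v" using ex_E0_left[OF v_fixed] by blast
  then show ?thesis using table_square[of h] E_bar_v[OF E0_subset_E, of h] by auto
qed

section \<open>The two minimal ideals\<close>

definition L1 :: "(biword \<Rightarrow> biword) set" where "L1 = {f \<in> E. f v = f w}"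

definition L2 :: "(biword \<Rightarrow> biword) set" where "L2 = {f \<in> E. f v = bar (f w)}"

lemma ideal_L1: "ellis_ideal X L1"
proof -
  obtain g where "table g w w" using ex_g1 by blast
  then have "g \<in> L1" using table_E by (auto simp: L1_def table_def)
  moreover have "compose X f g \<in> L1" if "f \<in> E" "g \<in> L1" for f g
    using that E_compose v_mem w_mem by (simp add: L1_def compose_eq)
  ultimately show ?thesis unfolding ellis_ideal_def by (auto simp: L1_def)
qed

lemma ideal_L2: "ellis_ideal X L2"
proof -
  obtain g where "table g (bar w) w" using ex_g2 by blast
  then have "g \<in> L2" using table_E by (auto simp: L2_def table_def)
  moreover have "compose X f g \<in> L2" if "f \<in> E" "g \<in> L2" for f g
  proof -
    have "f (g v) = bar (f (g w))"
      using that E_bar[of f "g w"] E_mem[of g w] w_mem by (simp add: L2_def)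
    then show ?thesis using that E_compose v_mem w_mem by (simp add: L2_def compose_eq)
  qed
  ultimately show ?thesis unfolding ellis_ideal_def by (auto simp: L2_def)
qed

lemma L1_L2_disjoint: "L1 \<inter> L2 = {}"
  by (auto simp: L1_def L2_def)

text \<open>\<open>g\<close> is a right identity on \<open>L1\<close>:
  \<open>f (g v) = f w = f v\<close>.\<close>

lemma L1_subset_ideal:
  assumes J: "ellis_ideal X J" and g: "table g w w" "g \<in> J"
  shows "L1 \<subseteq> J"
proof
  fix f assume f: "f \<in> L1"
  then have fE: "f \<in> E" by (simp add: L1_def)
  have "compose X f g = f"
    using f g(1) v_mem w_mem
    by (intro E_eqI E_compose fE table_E[OF g(1)]) (auto simp: L1_def table_def compose_eq)
  then show "f \<in> J" using J fE g(2) unfolding ellis_ideal_def by metis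
qed

text \<open>Again a right identity, now by
  \<open>f (g v) = f (bar w) = bar (f w) = f v\<close>.\<close>

lemma L2_subset_ideal:
  assumes J: "ellis_ideal X J" and g: "table g (bar w) w" "g \<in> J"
  shows "L2 \<subseteq> J"
proof
  fix f assume f: "f \<in> L2"
  then have fE: "f \<in> E" by (simp add: L2_def)
  have "compose X f g = f"
    using f g(1) v_mem w_mem E_bar_w[OF fE]
    by (intro E_eqI E_compose fE table_E[OF g(1)]) (auto simp: L2_def table_def compose_eq)
  then show "f \<in> J" using J fE g(2) unfolding ellis_ideal_def by metis
qed

lemma ideal_contains:
  assumes J: "ellis_ideal X J"
  shows "L1 \<subseteq> J \<or> L2 \<subseteq> J"
proof -
  have mult: "compose X f g \<in> J" if "f \<in> E" "g \<in> J" for f g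
    using J that unfolding ellis_ideal_def by blast
  obtain f where "f \<in> J" "f \<in> E" using J unfolding ellis_ideal_def by blast
  then obtain e where e: "e \<in> J" "e \<in> E0" using ex_left_multiple_in_E0[of f] mult by blast
  obtain g where g: "table g w w" using ex_g1 by blast
  \<comment> \<open>Left multiplication by \<open>g\<close> stays in \<open>J\<close> and moves all
    values at fixed points into \<open>{w, bar w}\<close>.\<close>
  define t where "t = compose X g e"
  have gE: "g \<in> E" using table_E[OF g] .
  have gF: "g u \<in> {w, bar w}" if "u \<in> F" for u
    using that g E_bar_v[OF gE] E_bar_w[OF gE] unfolding fixed_points_eq table_def by auto
  have t: "t \<in> J" "t \<in> E0" unfolding t_def
    using mult[OF gE e(1)] E0_compose[of g e] e g by (auto simp: table_def)
  have tv: "t v \<in> {w, bar w}" and tw: "t w \<in> {w, bar w}"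
    using gF E0_fixed[OF e(2)] v_fixed w_fixed v_mem w_mem by (simp_all add: t_def compose_eq)
  have tbar: "t (bar w) = bar (t w)" using E_bar_w[OF E0_subset_E[OF t(2)]] .
  have tt: "table (compose X t t) (t (t v)) (t (t w))" using table_square[OF t(2)] .
  have ttJ: "compose X t t \<in> J" using mult t E0_subset_E by blast
  \<comment> \<open>If \<open>t w = bar w\<close>, commuting with \<open>bar\<close> gives
    \<open>t (bar w) = w\<close>, so the square fixes \<open>w\<close> in both cases.\<close>
  have ttw: "t (t w) = w" using tw tbar by auto
  consider "t v = t w" | "t v = bar (t w)" using tv tw by auto
  then show ?thesis
  proof cases
    case 1
    then have "table (compose X t t) w w" using tt ttw by simp
    then show ?thesis using L1_subset_ideal[OF J] ttJ by blast
  next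
    case 2
    then have "t (t v) = bar w" using tw tbar by auto
    then have "table (compose X t t) (bar w) w" using tt ttw by simp
    then show ?thesis using L2_subset_ideal[OF J] ttJ by blast
  qed
qed

text \<open>Every ideal contains one of the disjoint nonempty ideals \<open>L1\<close> and
  \<open>L2\<close>, so no ideal lies properly inside either, and a minimal ideal must equal one of
  them.\<close>

lemma minimal_ideals_eq: "minimal_ideals X = {L1, L2}"
proof
  have ne: "L1 \<noteq> {}" "L2 \<noteq> {}" using ideal_L1 ideal_L2 unfolding ellis_ideal_def by auto
  show "minimal_ideals X \<subseteq> {L1, L2}"
  proof
    fix I assume I: "I \<in> minimal_ideals X"
    then have "L1 \<subseteq> I \<or> L2 \<subseteq> I" using ideal_contains unfolding minimal_ideals_def by blast
    then show "I \<in> {L1, L2}" using I ideal_L1 ideal_L2 unfolding minimal_ideals_def by blast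
  qed
  have "\<not> J \<subset> L1" "\<not> J \<subset> L2" if "ellis_ideal X J" for J
    using ideal_contains[OF that] L1_L2_disjoint ne by blast+
  then show "{L1, L2} \<subseteq> minimal_ideals X"
    using ideal_L1 ideal_L2 unfolding minimal_ideals_def by blast
qed

lemma table_idempotent:
  assumes g: "table g a b" and "g a = a" "g b = b"
  shows "g \<in> ellis_idempotents X"
proof -
  have gE: "g \<in> E" using table_E[OF g] .
  have "compose X g g = g"
    using assms v_mem w_mem
    by (intro E_eqI E_compose gE) (auto simp: table_def compose_eq)
  then show ?thesis using gE by (simp add: ellis_idempotents_def)
qed

lemma idempotents_L1:
  assumes "table g1 w w" "table g3 v v"
  shows "L1 \<inter> ellis_idempotents X = {g1, g3}"
proof
  show "{g1, g3} \<subseteq> L1 \<inter> ellis_idempotents X"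
    using table_idempotent[OF assms(1)] table_idempotent[OF assms(2)] assms table_E
    by (auto simp: L1_def table_def)
  show "L1 \<inter> ellis_idempotents X \<subseteq> {g1, g3}"
  proof
    fix e assume "e \<in> L1 \<inter> ellis_idempotents X"
    then have e: "e \<in> E" "compose X e e = e" "e v = e w" by (auto simp: L1_def ellis_idempotents_def)
    have t: "table e (e w) (e w)" using idempotent_table[OF e(1,2)] e(3) by simp
    have "e (e w) = e w" using compose_eq[OF w_mem, of e e] e(2) by simp
    moreover have "e w \<in> F" using t E0_fixed[OF _ w_fixed] by (auto simp: table_def)
    \<comment> \<open>\<open>e\<close> fixes \<open>e w\<close>, but \<open>e w = bar w\<close>
      would give \<open>e (bar w) = w\<close>, and \<open>e w = bar v\<close> would give
      \<open>e (bar v) = v\<close>.\<close>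
    ultimately have "e w = w \<or> e w = v"
      using e(3) E_bar_v[OF e(1)] E_bar_w[OF e(1)] unfolding fixed_points_eq by auto
    then show "e \<in> {g1, g3}" using t assms table_unique by auto
  qed
qed

lemma idempotents_L2:
  assumes "table g2 (bar w) w" "table g4 v (bar v)"
  shows "L2 \<inter> ellis_idempotents X = {g2, g4}"
proof
  have b: "g2 (bar w) = bar (g2 w)" "g4 (bar v) = bar (g4 v)"
    using E_bar_w[OF table_E[OF assms(1)]] E_bar_v[OF table_E[OF assms(2)]] by auto
  show "{g2, g4} \<subseteq> L2 \<inter> ellis_idempotents X"
    using table_idempotent[OF assms(1)] table_idempotent[OF assms(2)] assms table_E b
    by (auto simp: L2_def table_def)
  show "L2 \<inter> ellis_idempotents X \<subseteq> {g2, g4}"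
  proof
    fix e assume "e \<in> L2 \<inter> ellis_idempotents X"
    then have e: "e \<in> E" "compose X e e = e" "e v = bar (e w)"
      by (auto simp: L2_def ellis_idempotents_def)
    have t: "table e (bar (e w)) (e w)" using idempotent_table[OF e(1,2)] e(3) by simp
    have "e (e w) = e w" using compose_eq[OF w_mem, of e e] e(2) by simp
    moreover have "e w \<in> F" using t E0_fixed[OF _ w_fixed] by (auto simp: table_def)
    \<comment> \<open>Here \<open>e w = v\<close> is excluded, since then
      \<open>e v = bar v\<close>; \<open>bar w\<close> is excluded because then
      \<open>e (bar w) = w\<close>.\<close>
    ultimately have "e w = w \<or> e w = bar v"
      using e(3) E_bar_v[OF e(1)] E_bar_w[OF e(1)] unfolding fixed_points_eq by auto
    then show "e \<in> {g2, g4}" using t assms table_unique by auto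
  qed
qed

lemma table_shorthand:
  assumes g: "table g a b"
  shows "shorthand \<theta> g [(v, a), (bar v, bar a), (w, b), (bar w, bar b)]"
  using g E_shift[OF table_E[OF g]] E_bar_v[OF table_E[OF g]] E_bar_w[OF table_E[OF g]] v_mem w_mem
  by (auto simp: shorthand_def table_def)

lemma card_fixed_points: "card F = 4"
  by (simp add: fixed_points_eq)

end

theorem theorem52:
  fixes r :: nat and \<theta> :: subst
  assumes "continuous_substitution r \<theta>" and "canonical_form r \<theta>"
  shows "card (minimal_ideals (subst_shift \<theta>)) = 2
    \<and> (\<forall>I\<in>minimal_ideals (subst_shift \<theta>). card (I \<inter> ellis_idempotents (subst_shift \<theta>)) = 2)
    \<and> (\<exists>v w. fixed_points \<theta> = {v, bar v, w, bar w} \<and> card (fixed_points \<theta>) = 4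
        \<and> v (-1) = True \<and> v 0 = True \<and> w (-1) = False \<and> w 0 = True
        \<and> (\<exists>g1 g2 g3 g4. distinct [g1, g2, g3, g4]
            \<and> minimal_idempotents (subst_shift \<theta>) = {g1, g2, g3, g4}
            \<and> shorthand \<theta> g1 [(v, w),     (bar v, bar w), (w, w),     (bar w, bar w)]
            \<and> shorthand \<theta> g2 [(v, bar w), (bar v, w),     (w, w),     (bar w, bar w)]
            \<and> shorthand \<theta> g3 [(v, v),     (bar v, bar v), (w, v),     (bar w, bar v)]
            \<and> shorthand \<theta> g4 [(v, v),     (bar v, bar v), (w, bar v), (bar w, v)]))"
proof -
  interpret canonical_substitution r \<theta> using assms by unfold_locales
  obtain g1 g2 g3 g4 where g: "table g1 w w" "table g2 (bar w) w" "table g3 v v" "table g4 v (bar v)"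
    using ex_g1 ex_g2 ex_g3 ex_g4 by blast
  have dist: "distinct [g1, g2, g3, g4]" using g by (auto simp: table_def)
  have I: "L1 \<inter> ellis_idempotents X = {g1, g3}" "L2 \<inter> ellis_idempotents X = {g2, g4}"
    using idempotents_L1 idempotents_L2 g by blast+
  have "L1 \<noteq> L2" using L1_L2_disjoint ideal_L1 unfolding ellis_ideal_def by blast
  then have card: "card (minimal_ideals X) = 2" by (simp add: minimal_ideals_eq)
  have idem: "\<forall>I\<in>minimal_ideals X. card (I \<inter> ellis_idempotents X) = 2"
    using dist by (auto simp: minimal_ideals_eq I)
  have mem: "minimal_idempotents X = {g1, g2, g3, g4}"
    using I by (auto simp: minimal_idempotents_def minimal_ideals_eq)
  note gs = dist mem g[THEN table_shorthand, unfolded bar_bar]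
  have letters: "v (-1) = True" "v 0 = True" "w (-1) = False" "w 0 = True"
    using v_0 v_minus_1 w_0 w_minus_1 by simp_all
  show ?thesis
    by (rule conjI[OF card conjI[OF idem]], rule exI[of _ v], rule exI[of _ w],
        intro conjI fixed_points_eq card_fixed_points letters,
        rule exI[of _ g1], rule exI[of _ g2], rule exI[of _ g3], rule exI[of _ g4], intro conjI gs)
qed

end
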